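(* Let $p\in[1,2]$ and let $p_1$ be the conjugate exponent of $p$, i.e. $\frac1p+\frac1{p_1}=1$ (with $p_1=\infty$ if $p=1$). Then $$\|\mathbb{H}_Qf\|_{L_{p_1}(\mathbb{R})}\le \mathcal{C}_3\,\|f\|_{L_p(\mathbb{R})}\qquad\text{for all } f\in L_p(\mathbb{R}),$$ where $\mathcal{C}_3=\left(\sqrt{\frac{|b|}{2\pi}}\right)^{\alpha}$ and $\alpha=\frac2p-1$.
   Context: Let $a,b,c,d,e\in\mathbb{R}$ with $b\neq0$, and let $Q(x,y)=ax^2+bxy+cy^2+dx+ey$. Let $z\in\{i,-i\}$ be a square root of $-1$. The quadratic Hartley operator $\mathbb{H}_Q$ is defined by $$(\mathbb{H}_Qf)(x)=\sqrt{\frac{|b|}{2\pi}}\int_{\mathbb{R}}\left[\frac{e^{-iQ(x,y)}+z\,e^{-iQ(-x,y)}}{2}\right]f(y)\,dy .$$ For $f\in L_p(\mathbb{R})$ with $1<p\le 2$ the integral is understood, as for the Fourier transform, through the continuous extension of the operator from $L_1(\mathbb{R})\cap L_p(\mathbb{R})$ to $L_p(\mathbb{R})$. *)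

theory Defs
  imports "HOL-Probability.Essential_Supremum"
begin

text \<open>
  Complex \<open>L\<^sub>q(\<real>)\<close> for Lebesgue measure, \<open>q\<close> in \<open>[1,\<infinity>]\<close>. Elements are functions, not classes:
  functions that agree almost everywhere are at distance \<open>0\<close>.
\<close>

definition Lp_space :: "ennreal \<Rightarrow> (real \<Rightarrow> complex) set" where
  "Lp_space q = {f \<in> borel_measurable lebesgue.
     if q = \<infinity> then esssup lebesgue (\<lambda>x. ereal (norm (f x))) < \<infinity>
     else integrable lebesgue (\<lambda>x. norm (f x) powr enn2real q)}"

text \<open>Meaningful only on \<^term>\<open>Lp_space q\<close>.\<close>

definition Lp_norm :: "ennreal \<Rightarrow> (real \<Rightarrow> complex) \<Rightarrow> real" where
  "Lp_norm q f =
     (if q = \<infinity> then real_of_ereal (esssup lebesgue (\<lambda>x. ereal (norm (f x))))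
      else (LINT x|lebesgue. norm (f x) powr enn2real q) powr (1 / enn2real q))"

definition quad_phase :: "real \<Rightarrow> real \<Rightarrow> real \<Rightarrow> real \<Rightarrow> real \<Rightarrow> real \<Rightarrow> real \<Rightarrow> real" where
  "quad_phase a b c d e x y = a * x\<^sup>2 + b * x * y + c * y\<^sup>2 + d * x + e * y"

definition hartley_integral ::
    "real \<Rightarrow> real \<Rightarrow> real \<Rightarrow> real \<Rightarrow> real \<Rightarrow> complex \<Rightarrow> (real \<Rightarrow> complex) \<Rightarrow> real \<Rightarrow> complex" where
  "hartley_integral a b c d e z f x =
     complex_of_real (sqrt (\<bar>b\<bar> / (2 * pi))) *
     (LINT y|lebesgue.
        (exp (- \<i> * complex_of_real (quad_phase a b c d e x y))
          + z * exp (- \<i> * complex_of_real (quad_phase a b c d e (- x) y))) / 2 * f y)"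

text \<open>
  \<open>T\<close> is the continuous extension, as a map from \<open>L\<^sub>p(\<real>)\<close> to \<open>L\<^sub>q(\<real>)\<close>, of the integral operator
  on \<open>L\<^sub>1(\<real>) \<inter> L\<^sub>p(\<real>)\<close>. Since the latter is dense in \<open>L\<^sub>p(\<real>)\<close>, \<open>T\<close> is determined up to null sets
  and is linear modulo null sets. For \<open>p = 1\<close> it is the integral operator itself.
\<close>

definition is_hartley_extension ::
    "real \<Rightarrow> real \<Rightarrow> real \<Rightarrow> real \<Rightarrow> real \<Rightarrow> complex \<Rightarrow> ennreal \<Rightarrow> ennreal \<Rightarrow>
     ((real \<Rightarrow> complex) \<Rightarrow> real \<Rightarrow> complex) \<Rightarrow> bool" where
  "is_hartley_extension a b c d e z p q T \<longleftrightarrow>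
     (\<forall>f \<in> Lp_space p. T f \<in> Lp_space q) \<and>
     (\<forall>f \<in> Lp_space 1 \<inter> Lp_space p. T f = hartley_integral a b c d e z f) \<and>
     (\<forall>F f. (\<forall>n. F n \<in> Lp_space p) \<longrightarrow> f \<in> Lp_space p \<longrightarrow>
        (\<lambda>n. Lp_norm p (\<lambda>x. F n x - f x)) \<longlonglongrightarrow> 0 \<longrightarrow>
        (\<lambda>n. Lp_norm q (\<lambda>x. T (F n) x - T f x)) \<longlonglongrightarrow> 0)"

definition quad_hartley ::
    "real \<Rightarrow> real \<Rightarrow> real \<Rightarrow> real \<Rightarrow> real \<Rightarrow> complex \<Rightarrow> ennreal \<Rightarrow> ennreal \<Rightarrow>
     (real \<Rightarrow> complex) \<Rightarrow> real \<Rightarrow> complex" where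
  "quad_hartley a b c d e z p q = (SOME T. is_hartley_extension a b c d e z p q T)"

end

theory Submission
  imports Defs "HOL-Complex_Analysis.Conformal_Mappings" "HOL-Probability.Characteristic_Functions"
begin

text \<open>
  The integral operator maps \<open>L\<^sub>1\<close> to \<open>L\<^sub>\<infinity>\<close> with norm at most \<open>C\<close>, the square root of \<open>\<bar>b\<bar>/(2\<pi>)\<close>,
  because its kernel is bounded by \<open>C\<close>. Up to
  unimodular factors it is the mean of two Fourier integrals with frequencies \<open>b\<close> and \<open>-b\<close>, so it
  contracts \<open>L\<^sub>2\<close> as soon as Plancherel's inequality holds. That inequality is obtained by inserting
  the weight \<open>exp(-(\<sigma>b\<xi>)\<^sup>2/2)\<close>: the weighted \<open>L\<^sub>2\<close> norm of the transform is a quadratic form in \<open>f\<close> with a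
  Gaussian kernel of total mass \<open>2\<pi>/\<bar>b\<bar>\<close>, and \<open>\<sigma>\<close> tends to \<open>0\<close>. Thorin's argument (three lines
  theorem on simple functions, then duality) interpolates the two bounds on \<open>L\<^sub>1 \<inter> L\<^sub>p\<close>. By
  density and completeness the continuous extension exists, and every continuous extension inherits
  the bound.
\<close>

section \<open>The three lines theorem\<close>

text \<open>The exponent 2/p - 1 comes from 1/p = (1 - t) * 1 + t * (1/2): here t = 2 - 2/p, and
  only the share 1 - t of \<open>C\<close> survives because the constant at L_2 is exactly 1. That 1
  is a cancellation: the squared normalisation |b|/(2 pi) meets the Gaussian mass 2 pi/|b|, and
  averaging two transforms costs nothing. Duality turns the bound into one for the integral of g * T
  f; the dual exponent of q is p again, so both arguments live in L_p and are deformed by the same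
  analytic family. \<open>quad_hartley\<close> is an arbitrary choice among the continuous
  extensions. Constructing one only makes the choice meaningful; the estimate has to follow from
  agreement on L_1 \<inter> L_p and sequential continuity alone. Agreement is required at every
  point, whereas limits in L_q are fixed only up to null sets, so the constructed extension is the
  integral itself on integrable functions and a chosen limit elsewhere. The case p = 1 stays outside
  interpolation: q is infinite, and L_1 \<inter> L_p is all of L_1.\<close>

lemma three_lines:
  fixes F :: "complex \<Rightarrow> complex"
  assumes holo: "F holomorphic_on UNIV"
    and bounded: "\<And>z. 0 \<le> Re z \<Longrightarrow> Re z \<le> 1 \<Longrightarrow> norm (F z) \<le> K"
    and left: "\<And>z. Re z = 0 \<Longrightarrow> norm (F z) \<le> A"
    and right: "\<And>z. Re z = 1 \<Longrightarrow> norm (F z) \<le> B"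
    and "A > 0" "B > 0" "0 \<le> t" "t \<le> 1"
  shows "norm (F (of_real t)) \<le> A powr (1 - t) * B powr t"
proof -
  \<comment> \<open>Dividing by A^(1-z) B^z, written with \<open>exp\<close> and \<open>ln\<close>
    so that it is entire and free of zeros, makes both boundary bounds equal to 1.\<close>
  define G where "G z = F z * exp (- ((1 - z) * of_real (ln A)) - z * of_real (ln B))" for z
  have normG: "norm (G z) = norm (F z) / (A powr (1 - Re z) * B powr (Re z))" for z
    using \<open>A > 0\<close> \<open>B > 0\<close>
    by (simp add: G_def norm_mult norm_divide powr_def exp_add exp_diff exp_minus divide_simps)
  define L where "L = max 1 (max (1/A) (1/B))"
  have powr_inv: "1 / a powr s \<le> max 1 (1/a)" if "a > 0" "0 \<le> s" "s \<le> 1" for a s :: real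
  proof (cases "a \<ge> 1")
    case True
    then show ?thesis using that ge_one_powr_ge_zero[of a s] by (simp add: divide_simps le_max_iff_disj)
  next
    case False
    then have "a powr 1 \<le> a powr s" using that by (intro powr_mono') auto
    then show ?thesis using that by (simp add: divide_simps le_max_iff_disj)
  qed
  have K0: "K \<ge> 0" using bounded[of 0] by (auto intro: order_trans[OF norm_ge_zero])
  have Gbd: "norm (G z) \<le> K * (L * L)" if "0 \<le> Re z" "Re z \<le> 1" for z
  proof -
    have "norm (G z) = norm (F z) * (1 / A powr (1 - Re z) * (1 / B powr Re z))"
      by (simp add: normG)
    also have "\<dots> \<le> K * (L * L)"
    proof (intro mult_mono bounded that)
      show "1 / A powr (1 - Re z) \<le> L" "1 / B powr Re z \<le> L"
        using powr_inv[of A "1 - Re z"] powr_inv[of B "Re z"] that \<open>A > 0\<close> \<open>B > 0\<close>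
        by (auto simp: L_def)
    qed (use K0 in \<open>auto simp: L_def\<close>)
    finally show ?thesis .
  qed
  have Gleft: "norm (G z) \<le> 1" if "Re z = 0" for z
    using left[OF that] \<open>A > 0\<close> that \<open>B > 0\<close> by (simp add: normG)
  have Gright: "norm (G z) \<le> 1" if "Re z = 1" for z
    using right[OF that] \<open>B > 0\<close> that \<open>A > 0\<close> by (simp add: normG)
  have Gt: "norm (G (of_real t)) \<le> exp (\<epsilon> * (1 - t\<^sup>2))" if eps: "\<epsilon> > 0" for \<epsilon>
  proof -
    \<comment> \<open>The Gaussian factor decays along the strip, so the maximum principle on a tall rectangle applies.\<close>
    define H where "H z = G z * exp (of_real \<epsilon> * (z\<^sup>2 - 1))" for z
    define K' where "K' = K * (L * L)"
    \<comment> \<open>Large enough that the Gaussian factor beats the a priori bound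
      \<open>K'\<close> on the horizontal edges, by 1 + u \<le> exp u; the maximum with 1 keeps
      \<open>R\<close> positive.\<close>
    define R where "R = sqrt (max 1 (K' / \<epsilon>))"
    have R: "R > 0" "K' * exp (- \<epsilon> * R\<^sup>2) \<le> 1"
    proof -
      show "R > 0" by (simp add: R_def)
      have "K' / \<epsilon> \<le> R\<^sup>2" by (simp add: R_def)
      then have "K' \<le> \<epsilon> * R\<^sup>2" using eps by (simp add: pos_divide_le_eq mult.commute)
      also have "\<dots> \<le> exp (\<epsilon> * R\<^sup>2)" using exp_ge_add_one_self[of "\<epsilon> * R\<^sup>2"] by linarith
      finally show "K' * exp (- \<epsilon> * R\<^sup>2) \<le> 1" by (simp add: exp_minus field_simps)
    qed
    have normH: "norm (H z) = norm (G z) * exp (\<epsilon> * ((Re z)\<^sup>2 - (Im z)\<^sup>2 - 1))" for z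
      by (simp add: H_def norm_mult power2_eq_square)
    define Q where "Q = cbox (Complex 0 (-R)) (Complex 1 R)"
    have "norm (H (of_real t)) \<le> 1"
    proof (rule maximum_modulus_frontier[where S = Q and f = H and \<xi> = "of_real t"])
      show "H holomorphic_on interior Q"
        unfolding H_def G_def by (intro holomorphic_intros holomorphic_on_subset[OF holo]) auto
      show "continuous_on (closure Q) H"
        unfolding H_def G_def
        by (intro holomorphic_on_imp_continuous_on holomorphic_intros holomorphic_on_subset[OF holo]) auto
      show "bounded Q" by (simp add: Q_def)
      show "of_real t \<in> Q" using \<open>0 \<le> t\<close> \<open>t \<le> 1\<close> \<open>R > 0\<close> by (simp add: Q_def in_cbox_complex_iff)
      fix z assume "z \<in> frontier Q"
      then have "z \<in> Q" "z \<notin> box (Complex 0 (-R)) (Complex 1 R)"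
        by (auto simp: Q_def frontier_cbox)
      then have z: "0 \<le> Re z" "Re z \<le> 1" "\<bar>Im z\<bar> \<le> R"
        and "Re z = 0 \<or> Re z = 1 \<or> \<bar>Im z\<bar> = R"
        by (auto simp: Q_def in_cbox_complex_iff in_box_complex_iff)
      then consider "norm (G z) \<le> 1" | "(Im z)\<^sup>2 = R\<^sup>2" using Gleft Gright by (metis power2_abs)
      then show "norm (H z) \<le> 1"
      proof cases
        case 1
        have "(Re z)\<^sup>2 \<le> 1" using z by (simp add: power_le_one)
        then have "(Re z)\<^sup>2 - (Im z)\<^sup>2 - 1 \<le> 0" by (smt (verit) zero_le_power2)
        then have "exp (\<epsilon> * ((Re z)\<^sup>2 - (Im z)\<^sup>2 - 1)) \<le> 1"
          using eps by (simp add: mult_nonneg_nonpos)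
        with 1 show ?thesis unfolding normH by (intro mult_le_one) auto
      next
        case 2
        have "(Re z)\<^sup>2 \<le> 1" using z by (simp add: power_le_one)
        then have "\<epsilon> * ((Re z)\<^sup>2 - (Im z)\<^sup>2 - 1) \<le> \<epsilon> * (- R\<^sup>2)"
          using eps 2 by (intro mult_left_mono) auto
        then have "norm (H z) \<le> K' * exp (- \<epsilon> * R\<^sup>2)"
          unfolding normH using Gbd[OF z(1,2)] by (intro mult_mono) (auto simp: K'_def intro: order_trans[OF norm_ge_zero])
        with R show ?thesis by simp
      qed
    qed
    moreover have "norm (H (of_real t)) = norm (G (of_real t)) * exp (- (\<epsilon> * (1 - t\<^sup>2)))"
      by (simp add: normH algebra_simps)
    ultimately show ?thesis
      by (simp add: exp_minus pos_divide_le_eq flip: divide_inverse)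
  qed
  have "norm (G (of_real t)) \<le> 1"
  proof (rule tendsto_lowerbound)
    show "((\<lambda>\<epsilon>. exp (\<epsilon> * (1 - t\<^sup>2))) \<longlongrightarrow> 1) (at_right 0)"
      by (rule tendsto_eq_intros refl | simp)+
    show "\<forall>\<^sub>F \<epsilon> in at_right 0. norm (G (of_real t)) \<le> exp (\<epsilon> * (1 - t\<^sup>2))"
      using Gt by (auto simp: eventually_at_right_less intro: eventually_mono[OF eventually_at_right_less])
  qed auto
  then show ?thesis using \<open>A > 0\<close> \<open>B > 0\<close> by (simp add: normG divide_simps)
qed

section \<open>Seminorms of order \<open>r\<close>\<close>

definition Lr :: "'a measure \<Rightarrow> real \<Rightarrow> ('a \<Rightarrow> complex) set" where
  "Lr M r = {f \<in> borel_measurable M. integrable M (\<lambda>x. norm (f x) powr r)}"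

definition Lr_norm :: "'a measure \<Rightarrow> real \<Rightarrow> ('a \<Rightarrow> complex) \<Rightarrow> real" where
  "Lr_norm M r f = (LINT x|M. norm (f x) powr r) powr (1 / r)"

lemma Lr_norm_nonneg [simp]: "Lr_norm M r f \<ge> 0"
  by (simp add: Lr_norm_def)

lemma Lr_measurable: "f \<in> Lr M r \<Longrightarrow> f \<in> borel_measurable M"
  by (simp add: Lr_def)

lemma Lr_1: "f \<in> Lr M 1 \<longleftrightarrow> integrable M f"
  by (auto simp: Lr_def integrable_norm_iff)

lemma Lr_norm_powr: "r > 0 \<Longrightarrow> Lr_norm M r f powr r = (LINT x|M. norm (f x) powr r)"
  by (simp add: Lr_norm_def powr_powr)

lemma Lr_norm_le_iff:
  assumes "r > 0" "A \<ge> 0"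
  shows "Lr_norm M r f \<le> A \<longleftrightarrow> (LINT x|M. norm (f x) powr r) \<le> A powr r"
proof -
  have "Lr_norm M r f \<le> A \<longleftrightarrow> Lr_norm M r f powr r \<le> A powr r"
    using assms by (auto intro: powr_mono2 simp: not_le dest: powr_less_mono2[of r A "Lr_norm M r f"])
  then show ?thesis using assms by (simp add: Lr_norm_powr)
qed

text \<open>A finite nonnegative integral yields integrability as well. A bound on the Bochner
  integral alone would say nothing, since that integral is 0 for functions that are not
  integrable.\<close>

lemma Lr_nn_integral_le:
  assumes "r > 0" "A \<ge> 0" and [measurable]: "f \<in> borel_measurable M"
    and "(\<integral>\<^sup>+x. ennreal (norm (f x) powr r) \<partial>M) \<le> ennreal (A powr r)"
  shows "f \<in> Lr M r" "Lr_norm M r f \<le> A"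
proof -
  have int: "integrable M (\<lambda>x. norm (f x) powr r)"
    using assms(4) by (intro integrableI_bounded) (auto simp: intro: le_less_trans)
  then show "f \<in> Lr M r" by (simp add: Lr_def)
  show "Lr_norm M r f \<le> A"
    using assms int by (simp add: Lr_norm_le_iff nn_integral_eq_integral)
qed

lemma Lr_nn_integral:
  assumes "r > 0" "f \<in> Lr M r"
  shows "(\<integral>\<^sup>+x. ennreal (norm (f x) powr r) \<partial>M) = ennreal (Lr_norm M r f powr r)"
  using assms by (simp add: Lr_norm_powr Lr_def nn_integral_eq_integral)

section \<open>Minkowski's inequality by convexity, and density of the integrable functions\<close>

lemma convex_on_powr_nonneg:
  assumes "r \<ge> 1"
  shows "convex_on {0..} (\<lambda>x::real. x powr r)"
proof (intro convex_onI)
  fix t x y :: real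
  assume t: "0 < t" "t < 1" and xy: "x \<in> {0..}" "y \<in> {0..}"
  \<comment> \<open>\<open>powr_convex\<close> covers the open half line. If one of the points is 0,
    convexity reduces to s^r \<le> s for 0 < s < 1.\<close>
  have scale: "(s * w) powr r \<le> s * w powr r" if "0 < s" "s < 1" "w \<ge> 0" for s w :: real
  proof -
    have "s powr r \<le> s powr 1" using that assms by (intro powr_mono') auto
    then show ?thesis using that by (simp add: powr_mult mult_right_mono)
  qed
  show "((1 - t) *\<^sub>R x + t *\<^sub>R y) powr r \<le> (1 - t) * x powr r + t * y powr r"
  proof (cases "x = 0 \<or> y = 0")
    case True
    then show ?thesis using scale[of t y] scale[of "1 - t" x] t xy by auto
  next
    case False
    then show ?thesis using t xy by (intro convex_onD[OF powr_convex[OF assms]]) auto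
  qed
qed auto

text \<open>Convexity at the points x / a and y / b with weights a / (a + b) and b / (a + b). When a
  and b bound the two norms, each ratio integrates to at most 1, and Minkowski's inequality drops
  out.\<close>

lemma powr_convex_combination:
  fixes a b x y r :: real
  assumes "r \<ge> 1" "a > 0" "b > 0" "x \<ge> 0" "y \<ge> 0"
  shows "(x + y) powr r \<le> (a + b) powr r * (a / (a + b) * (x powr r / a powr r) + b / (a + b) * (y powr r / b powr r))"
proof -
  have conv: "convex_on {0..} (\<lambda>x::real. x powr r)"
    using assms by (intro convex_on_powr_nonneg)
  have "((1 - b / (a + b)) *\<^sub>R (x / a) + (b / (a + b)) *\<^sub>R (y / b)) powr r \<le>
     (1 - b / (a + b)) * (x / a) powr r + b / (a + b) * (y / b) powr r"
    using assms by (intro convex_onD[OF conv]) (auto simp: divide_simps)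
  moreover have "1 - b / (a + b) = a / (a + b)" using assms by (simp add: divide_simps)
  moreover have "(1 - b / (a + b)) *\<^sub>R (x / a) + (b / (a + b)) *\<^sub>R (y / b) = (x + y) / (a + b)"
    using assms by (simp add: divide_simps)
  ultimately have "((x + y) / (a + b)) powr r \<le> a / (a + b) * (x powr r / a powr r) + b / (a + b) * (y powr r / b powr r)"
    using assms by (simp add: powr_divide)
  then show ?thesis
    using assms by (simp add: powr_divide divide_simps mult.commute)
qed

lemma Minkowski:
  assumes r: "r \<ge> 1" and f: "f \<in> Lr M r" and g: "g \<in> Lr M r"
  shows "(\<lambda>x. f x + g x) \<in> Lr M r" "Lr_norm M r (\<lambda>x. f x + g x) \<le> Lr_norm M r f + Lr_norm M r g"
proof -
  note [measurable] = Lr_measurable[OF f] Lr_measurable[OF g]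
  have if': "integrable M (\<lambda>x. norm (f x) powr r)" and ig: "integrable M (\<lambda>x. norm (g x) powr r)"
    using f g by (auto simp: Lr_def)
  have pt: "norm (f x + g x) powr r \<le> (a + b) powr r *
       (a / (a + b) * (norm (f x) powr r / a powr r) + b / (a + b) * (norm (g x) powr r / b powr r))"
    if "a > 0" "b > 0" for a b x
    by (rule order_trans[OF powr_mono2 powr_convex_combination]) (use r that norm_triangle_ineq in auto)
  have int: "integrable M (\<lambda>x. norm (f x + g x) powr r)"
  proof (rule Bochner_Integration.integrable_bound)
    show "integrable M (\<lambda>x. 2 powr r * (norm (f x) powr r / 2 + norm (g x) powr r / 2))"
      using if' ig by simp
  qed (use pt[of 1 1] in auto)
  then show "(\<lambda>x. f x + g x) \<in> Lr M r" by (auto simp: Lr_def)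
  \<comment> \<open>Strictly positive majorants stand in for the norms, which may be 0 and then
    could not be divided by; the slack \<open>\<epsilon>\<close> is removed afterwards.\<close>
  have *: "Lr_norm M r (\<lambda>x. f x + g x) \<le> a + b"
    if ab: "a > 0" "b > 0" "Lr_norm M r f \<le> a" "Lr_norm M r g \<le> b" for a b
  proof -
    have fa: "(LINT x|M. norm (f x) powr r) / a powr r \<le> 1" and gb: "(LINT x|M. norm (g x) powr r) / b powr r \<le> 1"
      using ab r by (auto simp: Lr_norm_le_iff)
    have "(LINT x|M. norm (f x + g x) powr r) \<le> (LINT x|M. (a + b) powr r *
       (a / (a + b) * (norm (f x) powr r / a powr r) + b / (a + b) * (norm (g x) powr r / b powr r)))"
      using int if' ig by (intro integral_mono pt ab) auto
    also have "\<dots> = (a + b) powr r * (a / (a + b) * ((LINT x|M. norm (f x) powr r) / a powr r)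
        + b / (a + b) * ((LINT x|M. norm (g x) powr r) / b powr r))"
      using if' ig by simp
    also have "\<dots> \<le> (a + b) powr r * (a / (a + b) * 1 + b / (a + b) * 1)"
      by (intro mult_left_mono add_mono fa gb) (use ab in auto)
    also have "\<dots> = (a + b) powr r" using ab by (simp add: add_divide_distrib[symmetric])
    finally show ?thesis using r ab by (simp add: Lr_norm_le_iff)
  qed
  show "Lr_norm M r (\<lambda>x. f x + g x) \<le> Lr_norm M r f + Lr_norm M r g"
  proof (rule field_le_epsilon)
    fix \<epsilon> :: real assume "\<epsilon> > 0"
    then show "Lr_norm M r (\<lambda>x. f x + g x) \<le> Lr_norm M r f + Lr_norm M r g + \<epsilon>"
      using *[of "Lr_norm M r f + \<epsilon>/2" "Lr_norm M r g + \<epsilon>/2"] by (simp add: add_nonneg_pos)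
  qed
qed

lemma Lr_uminus: "(\<lambda>x. - f x) \<in> Lr M r \<longleftrightarrow> f \<in> Lr M r"
  by (auto simp: Lr_def dest: borel_measurable_uminus)

lemma Lr_norm_minus_commute: "Lr_norm M r (\<lambda>x. f x - g x) = Lr_norm M r (\<lambda>x. g x - f x)"
  by (simp add: Lr_norm_def norm_minus_commute)

lemma Minkowski_diff:
  assumes "r \<ge> 1" "f \<in> Lr M r" "g \<in> Lr M r"
  shows "(\<lambda>x. f x - g x) \<in> Lr M r" "Lr_norm M r (\<lambda>x. f x - g x) \<le> Lr_norm M r f + Lr_norm M r g"
  using Minkowski[of r f M "\<lambda>x. - g x"] assms by (auto simp: Lr_uminus Lr_norm_def)

lemma Minkowski_triangle:
  assumes "r \<ge> 1" "(\<lambda>x. f x - g x) \<in> Lr M r" "(\<lambda>x. g x - h x) \<in> Lr M r"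
  shows "Lr_norm M r (\<lambda>x. f x - h x) \<le> Lr_norm M r (\<lambda>x. f x - g x) + Lr_norm M r (\<lambda>x. g x - h x)"
  using Minkowski(2)[OF assms] by simp

text \<open>Deleting the small values of f makes it integrable: where |f| \<ge> 1/(n+1), the factor
  ((n+1) |f|)^(p-1) is at least 1, so |f| \<le> (n+1)^(p-1) |f|^p. At each point the truncation is
  eventually exact, and the error is dominated by |f|^p.\<close>

lemma Lr_dense:
  assumes p: "p \<ge> 1" and f: "f \<in> Lr M p"
  obtains F where "\<And>n. F n \<in> Lr M p" "\<And>n. integrable M (F n)"
    "(\<lambda>n. Lr_norm M p (\<lambda>x. F n x - f x)) \<longlonglongrightarrow> 0"
proof
  define F where "F n x = (if norm (f x) \<ge> 1 / Suc n then f x else 0)" for n :: nat and x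
  note [measurable] = Lr_measurable[OF f]
  have intf: "integrable M (\<lambda>x. norm (f x) powr p)" using f by (simp add: Lr_def)
  have Fm[measurable]: "F n \<in> borel_measurable M" for n unfolding F_def by measurable
  show "F n \<in> Lr M p" for n
    unfolding Lr_def by (auto intro!: Bochner_Integration.integrable_bound[OF intf] simp: F_def)
  show "integrable M (F n)" for n
  proof (rule Bochner_Integration.integrable_bound[OF integrable_mult_right[OF intf, of "real (Suc n) powr (p - 1)"]])
    have "norm (f x) \<le> real (Suc n) powr (p - 1) * norm (f x) powr p" if "norm (f x) \<ge> 1 / Suc n" for x
    proof -
      have pos: "norm (f x) > 0" using that by (smt (verit) divide_pos_pos of_nat_0_less_iff zero_less_Suc)
      have "1 \<le> (real (Suc n) * norm (f x)) powr (p - 1)"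
        using that p by (intro ge_one_powr_ge_zero) (auto simp: field_simps)
      then have "norm (f x) * 1 \<le> norm (f x) * (real (Suc n) * norm (f x)) powr (p - 1)"
        by (intro mult_left_mono) auto
      also have "\<dots> = real (Suc n) powr (p - 1) * (norm (f x) powr (p - 1) * norm (f x) powr 1)"
        using pos by (simp add: powr_mult)
      also have "\<dots> = real (Suc n) powr (p - 1) * norm (f x) powr p"
        unfolding powr_add[symmetric] by simp
      finally show ?thesis by simp
    qed
    then show "AE x in M. norm (F n x) \<le> norm (real (Suc n) powr (p - 1) * norm (f x) powr p)"
      by (auto simp: F_def)
  qed simp
  have "(\<lambda>n. LINT x|M. norm (F n x - f x) powr p) \<longlonglongrightarrow> (LINT x|M. 0)"
  proof (rule integral_dominated_convergence[OF _ _ intf])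
    show "AE x in M. (\<lambda>n. norm (F n x - f x) powr p) \<longlonglongrightarrow> 0"
    proof (intro AE_I2)
      fix x
      have "eventually (\<lambda>n. F n x = f x) sequentially"
      proof (cases "f x = 0")
        case False
        then have "eventually (\<lambda>n. inverse (real (Suc n)) < norm (f x)) sequentially"
          by (intro order_tendstoD[OF LIMSEQ_inverse_real_of_nat]) auto
        then show ?thesis by eventually_elim (auto simp: F_def inverse_eq_divide)
      qed (auto simp: F_def)
      then have "eventually (\<lambda>n. norm (F n x - f x) powr p = 0) sequentially"
        by eventually_elim auto
      then show "(\<lambda>n. norm (F n x - f x) powr p) \<longlonglongrightarrow> 0" by (rule tendsto_eventually)
    qed
  qed (auto simp: F_def)
  then have "(\<lambda>n. Lr_norm M p (\<lambda>x. F n x - f x)) \<longlonglongrightarrow> (LINT x|M. 0) powr (1 / p)"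
    unfolding Lr_norm_def using p by (intro tendsto_powr') auto
  then show "(\<lambda>n. Lr_norm M p (\<lambda>x. F n x - f x)) \<longlonglongrightarrow> 0" by simp
qed

section \<open>Interpolation between \<open>L\<^sub>1 \<rightarrow> L\<^sub>\<infinity>\<close> and \<open>L\<^sub>2 \<rightarrow> L\<^sub>2\<close>\<close>

text \<open>
  At \<^term>\<open>Re z = 0\<close> the modulus is \<open>\<bar>w\<bar>\<^sup>p\<close>, at \<^term>\<open>Re z = 1\<close> it is \<open>\<bar>w\<bar>\<close> to the power \<open>p/2\<close>,
  and at \<open>z = 2 - 2/p\<close> the value is \<open>w\<close> itself.
\<close>

definition thorin_family :: "real \<Rightarrow> complex \<Rightarrow> complex \<Rightarrow> complex" where
  "thorin_family p z w = (if w = 0 then 0 else sgn w * exp (of_real p * (1 - z / 2) * of_real (ln (norm w))))"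

lemma norm_thorin_family: "norm (thorin_family p z w) = norm w powr (p * (1 - Re z / 2))"
  by (simp add: thorin_family_def norm_mult norm_sgn powr_def)

lemma thorin_family_0 [simp]: "thorin_family p z 0 = 0"
  by (simp add: thorin_family_def)

lemma thorin_family_real:
  assumes "p * (1 - t / 2) = 1"
  shows "thorin_family p (of_real t) w = w"
proof (cases "w = 0")
  case False
  have "of_real p * (1 - of_real t / 2) = (1::complex)"
    using assms by (metis of_real_1 of_real_diff of_real_divide of_real_mult of_real_numeral)
  then show ?thesis using False
    by (simp add: thorin_family_def exp_of_real sgn_eq)
qed simp

lemma holomorphic_thorin_family: "(\<lambda>z. thorin_family p z w) holomorphic_on A"
  unfolding thorin_family_def by (cases "w = 0") (auto intro!: holomorphic_intros)

text \<open>Meant for \<open>\<phi> = thorin_family p z\<close>: the level sets do not depend on z,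
  so the deformed function is a finite sum with coefficients holomorphic in z. Since
  \<open>\<phi> 0 = 0\<close>, the level set of 0 can be left out, the only one that may have
  infinite measure when f is integrable.\<close>

lemma simple_function_sum_indicator:
  fixes f :: "'a \<Rightarrow> complex"
  assumes "simple_function M f" "x \<in> space M" "\<phi> 0 = 0"
  shows "\<phi> (f x) = (\<Sum>w\<in>f ` space M - {0}. \<phi> w * indicator (f -` {w} \<inter> space M) x :: complex)"
proof (cases "f x = 0")
  case True
  then show ?thesis using assms by (auto intro!: sum.neutral split: split_indicator)
next
  case False
  have fin: "finite (f ` space M)" using assms(1) by (rule simple_functionD)
  have "(\<Sum>w\<in>f ` space M - {0}. \<phi> w * indicator (f -` {w} \<inter> space M) x) =
    (\<Sum>w\<in>f ` space M - {0}. if w = f x then \<phi> w else 0)"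
    using assms(2) by (intro sum.cong) (auto split: split_indicator)
  also have "\<dots> = \<phi> (f x)" using fin False assms(2) by (simp add: sum.delta)
  finally show ?thesis by simp
qed

lemma integrable_simple_function_level:
  fixes f :: "'a \<Rightarrow> complex"
  assumes f: "simple_function M f" "integrable M f" and "w \<noteq> 0"
  shows "integrable M (indicator (f -` {w} \<inter> space M) :: 'a \<Rightarrow> complex)"
proof (rule Bochner_Integration.integrable_bound[OF integrable_mult_right[OF integrable_norm[OF f(2)], of "1 / norm w"]])
  show "indicator (f -` {w} \<inter> space M) \<in> borel_measurable M"
    using simple_functionD(2)[OF f(1)] by (intro borel_measurable_indicator)
  show "AE x in M. norm (indicator (f -` {w} \<inter> space M) x :: complex) \<le> norm (1 / norm w * norm (f x))"
    using \<open>w \<noteq> 0\<close> by (auto split: split_indicator)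
qed

lemma integrable_simple_function_comp:
  fixes f :: "'a \<Rightarrow> complex"
  assumes f: "simple_function M f" "integrable M f" and "\<phi> 0 = 0"
  shows "integrable M (\<lambda>x. \<phi> (f x) :: complex)"
proof -
  have "integrable M (\<lambda>x. \<Sum>w\<in>f ` space M - {0}. \<phi> w * indicator (f -` {w} \<inter> space M) x)"
    using integrable_simple_function_level[OF f] by (intro Bochner_Integration.integrable_sum integrable_mult_right) auto
  then show ?thesis
    using simple_function_sum_indicator[OF f(1), of _ \<phi>] assms(3)
    by (subst Bochner_Integration.integrable_cong[OF refl]) auto
qed

lemma ennreal_power2_le_imp_le:
  assumes "x\<^sup>2 \<le> (ennreal s)\<^sup>2" "s \<ge> 0"
  shows "x \<le> ennreal s"
proof (cases x)
  case (real r)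
  then have "r\<^sup>2 \<le> s\<^sup>2" using assms by (simp add: ennreal_power ennreal_le_iff)
  then show ?thesis using real assms by (auto intro: ennreal_leI power2_le_imp_le)
next
  case top
  then show ?thesis using assms by (simp add: ennreal_power top_unique)
qed

lemma integral_Cauchy_Schwarz:
  fixes f g :: "'a \<Rightarrow> complex"
  assumes [measurable]: "f \<in> borel_measurable M" "g \<in> borel_measurable M"
    and "A \<ge> 0" "B \<ge> 0"
    and "(\<integral>\<^sup>+x. ennreal ((norm (f x))\<^sup>2) \<partial>M) \<le> ennreal A" "(\<integral>\<^sup>+x. ennreal ((norm (g x))\<^sup>2) \<partial>M) \<le> ennreal B"
  shows "norm (LINT x|M. f x * g x) \<le> sqrt (A * B)"
proof -
  have "(\<integral>\<^sup>+x. ennreal (norm (f x)) * ennreal (norm (g x)) \<partial>M)\<^sup>2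
    \<le> (\<integral>\<^sup>+x. (ennreal (norm (f x)))\<^sup>2 \<partial>M) * (\<integral>\<^sup>+x. (ennreal (norm (g x)))\<^sup>2 \<partial>M)"
    by (intro Cauchy_Schwarz_nn_integral) auto
  also have "\<dots> \<le> ennreal A * ennreal B"
    using assms by (intro mult_mono) (auto simp: ennreal_power)
  also have "\<dots> = (ennreal (sqrt (A * B)))\<^sup>2"
    using assms by (simp add: ennreal_power ennreal_mult)
  finally have sq: "(\<integral>\<^sup>+x. ennreal (norm (f x)) * ennreal (norm (g x)) \<partial>M)\<^sup>2 \<le> (ennreal (sqrt (A * B)))\<^sup>2" .
  \<comment> \<open>Outside the integrable case the Bochner integral is 0 by convention, so the
    bound by the nonnegative integral holds there too.\<close>
  have "ennreal (norm (LINT x|M. f x * g x)) \<le> (\<integral>\<^sup>+x. ennreal (norm (f x * g x)) \<partial>M)"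
    by (cases "integrable M (\<lambda>x. f x * g x)")
       (auto intro: integral_norm_bound_ennreal simp: not_integrable_integral_eq)
  also have "\<dots> = (\<integral>\<^sup>+x. ennreal (norm (f x)) * ennreal (norm (g x)) \<partial>M)"
    by (simp add: norm_mult ennreal_mult)
  also have "\<dots> \<le> ennreal (sqrt (A * B))"
    using sq by (rule ennreal_power2_le_imp_le) (use assms in simp)
  finally show ?thesis using assms by (simp add: ennreal_le_iff)
qed

text \<open>Interpolation sees the kernel only through linearity and the two endpoint bounds. The
  L_2 bound is a nonnegative integral, so that it includes the claim that T f lies in L_2;
  sigma-finiteness of the target supplies the exhaustion by sets of finite measure used for
  duality.\<close>

locale L1_L2_operator = N: sigma_finite_measure N
  for M :: "'a measure" and N :: "'b measure" +
  fixes T :: "('a \<Rightarrow> complex) \<Rightarrow> 'b \<Rightarrow> complex" and C :: real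
  assumes C_pos: "0 < C"
    and T_measurable: "integrable M f \<Longrightarrow> T f \<in> borel_measurable N"
    and T_add: "integrable M f \<Longrightarrow> integrable M g \<Longrightarrow> T (\<lambda>y. f y + g y) x = T f x + T g x"
    and T_mult: "integrable M f \<Longrightarrow> T (\<lambda>y. c * f y) x = c * T f x"
    and T_bound: "integrable M f \<Longrightarrow> norm (T f x) \<le> C * (LINT y|M. norm (f y))"
    and T_L2: "integrable M f \<Longrightarrow> integrable M (\<lambda>y. (norm (f y))\<^sup>2) \<Longrightarrow>
      (\<integral>\<^sup>+x. ennreal ((norm (T f x))\<^sup>2) \<partial>N) \<le> ennreal (LINT y|M. (norm (f y))\<^sup>2)"
begin

lemma T_diff:
  assumes "integrable M f" "integrable M g"
  shows "T (\<lambda>y. f y - g y) x = T f x - T g x"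
  using T_add[of f "\<lambda>y. -1 * g y" x] T_mult[of g "-1" x] assms by simp

text \<open>\<open>T\<close> acts on functions, and a simple function equals its sum over level sets
  only on \<open>space M\<close>; the L_1 bound shows that \<open>T\<close> ignores values
  elsewhere.\<close>

lemma T_cong:
  assumes "integrable M f" "integrable M g" "\<And>y. y \<in> space M \<Longrightarrow> f y = g y"
  shows "T f x = T g x"
proof -
  have "norm (T (\<lambda>y. f y - g y) x) \<le> C * (LINT y|M. norm (f y - g y))"
    using assms by (intro T_bound) auto
  also have "(LINT y|M. norm (f y - g y)) = (LINT y|M. 0)"
    using assms by (intro Bochner_Integration.integral_cong) auto
  finally show ?thesis using assms by (simp add: T_diff)
qed

lemma T_sum:
  assumes "finite I" "\<And>i. i \<in> I \<Longrightarrow> integrable M (f i)"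
  shows "T (\<lambda>y. \<Sum>i\<in>I. c i * f i y) x = (\<Sum>i\<in>I. c i * T (f i) x)"
  using assms
proof (induction I)
  case empty
  then show ?case using T_mult[of "\<lambda>_. 0" 0 x] by simp
next
  case (insert i I)
  then show ?case
    using T_add[of "\<lambda>y. c i * f i y" "\<lambda>y. \<Sum>i\<in>I. c i * f i y" x] by (simp add: T_mult)
qed

lemma integrable_T_mult:
  assumes "integrable M f" "integrable N g"
  shows "integrable N (\<lambda>x. g x * T f x)"
proof (rule Bochner_Integration.integrable_bound[OF integrable_mult_right[OF integrable_norm[OF assms(2)], of "C * (LINT y|M. norm (f y))"]])
  show "(\<lambda>x. g x * T f x) \<in> borel_measurable N"
    using assms T_measurable[OF assms(1)] by auto
  have "norm (T f x) * norm (g x) \<le> C * (LINT y|M. norm (f y)) * norm (g x)" for x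
    by (intro mult_right_mono T_bound assms) auto
  then show "AE x in N. norm (g x * T f x) \<le> norm (C * (LINT y|M. norm (f y)) * norm (g x))"
    using C_pos by (auto simp: norm_mult mult.commute)
qed

text \<open>Bilinear, without a conjugate on g, so that pairing two holomorphic families gives a
  holomorphic function.\<close>

definition form :: "('a \<Rightarrow> complex) \<Rightarrow> ('b \<Rightarrow> complex) \<Rightarrow> complex" where
  "form f g = (LINT x|N. g x * T f x)"

lemma form_bound_L1:
  assumes "integrable M f" "integrable N g"
  shows "norm (form f g) \<le> C * (LINT y|M. norm (f y)) * (LINT x|N. norm (g x))"
proof -
  have "norm (form f g) \<le> (LINT x|N. norm (g x * T f x))"
    unfolding form_def by (rule integral_norm_bound)
  also have "\<dots> \<le> (LINT x|N. norm (g x) * (C * (LINT y|M. norm (f y))))"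
    using assms by (intro integral_mono integrable_norm integrable_T_mult integrable_mult_left)
      (auto simp: norm_mult intro: mult_left_mono T_bound)
  finally show ?thesis by (simp add: mult.commute)
qed

lemma form_bound_L2:
  assumes "integrable M f" "integrable M (\<lambda>y. (norm (f y))\<^sup>2)"
    and "integrable N g" "integrable N (\<lambda>x. (norm (g x))\<^sup>2)"
  shows "norm (form f g) \<le> sqrt ((LINT y|M. (norm (f y))\<^sup>2) * (LINT x|N. (norm (g x))\<^sup>2))"
  unfolding form_def
  by (subst mult.commute, rule integral_Cauchy_Schwarz)
    (use assms T_measurable[of f] T_L2[of f] in \<open>auto simp: nn_integral_eq_integral mult.commute\<close>)

text \<open>With X and Y the integrals of |f|^p and |g|^p, the deformed functions have L_1 norms X
  and Y on the left edge of the strip and squared L_2 norms X and Y on the right edge. The three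
  lines theorem between C X Y and sqrt (X Y) gives C^(1-t) (X Y)^(1-t/2), and 1 - t/2 = 1/p.\<close>

lemma form_interpolation_simple:
  assumes p: "1 \<le> p" "p \<le> 2"
    and f: "simple_function M f" "integrable M f" and g: "simple_function N g" "integrable N g"
  shows "norm (form f g) \<le> C powr (2 / p - 1) * Lr_norm M p f * Lr_norm N p g"
proof -
  define X where "X = (LINT y|M. norm (f y) powr p)"
  define Y where "Y = (LINT x|N. norm (g x) powr p)"
  have X0: "X \<ge> 0" and Y0: "Y \<ge> 0" by (simp_all add: X_def Y_def)
  have comp_f: "integrable M (\<lambda>y. norm (\<phi> (f y)))" if "\<phi> 0 = 0" for \<phi> :: "complex \<Rightarrow> complex"
    using integrable_simple_function_comp[OF f, of \<phi>] that by (intro integrable_norm)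
  have comp_g: "integrable N (\<lambda>y. norm (\<phi> (g y)))" if "\<phi> 0 = 0" for \<phi> :: "complex \<Rightarrow> complex"
    using integrable_simple_function_comp[OF g, of \<phi>] that by (intro integrable_norm)
  have intX: "integrable M (\<lambda>y. norm (f y) powr p)"
    using comp_f[of "\<lambda>w. of_real (norm w powr p)"] by simp
  have intY: "integrable N (\<lambda>y. norm (g y) powr p)"
    using comp_g[of "\<lambda>w. of_real (norm w powr p)"] by simp
  let ?\<Phi> = "thorin_family p"
  have iF: "integrable M (\<lambda>y. ?\<Phi> z (f y))" for z
    by (intro integrable_simple_function_comp[OF f, where \<phi> = "?\<Phi> z"]) simp
  have iG: "integrable N (\<lambda>x. ?\<Phi> z (g x))" for z
    by (intro integrable_simple_function_comp[OF g, where \<phi> = "?\<Phi> z"]) simp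
  define F where "F z = form (\<lambda>y. ?\<Phi> z (f y)) (\<lambda>x. ?\<Phi> z (g x))" for z
  define t where "t = 2 - 2 / p"
  have t: "0 \<le> t" "t \<le> 1" "p * (1 - t / 2) = 1" using p by (auto simp: t_def field_simps)
  define S where "S = f ` space M - {0}"
  define R where "R = g ` space N - {0}"
  have fin: "finite S" "finite R" using simple_functionD(1)[OF f(1)] simple_functionD(1)[OF g(1)] by (auto simp: S_def R_def)
  let ?A = "\<lambda>w. indicator (f -` {w} \<inter> space M) :: 'a \<Rightarrow> complex"
  let ?D = "\<lambda>v. indicator (g -` {v} \<inter> space N) :: 'b \<Rightarrow> complex"
  have intA: "integrable M (?A w)" if "w \<in> S" for w
    using that by (intro integrable_simple_function_level f) (auto simp: S_def)
  have intD: "integrable N (?D v)" if "v \<in> R" for v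
    using that by (intro integrable_simple_function_level g) (auto simp: R_def)
  \<comment> \<open>Holomorphy becomes visible after expansion: z enters only through finitely many
    coefficients, while the pairings of indicators are constants.\<close>
  have F_eq: "F z = (\<Sum>v\<in>R. \<Sum>w\<in>S. ?\<Phi> z v * ?\<Phi> z w * form (?A w) (?D v))" for z
  proof -
    have Tz: "T (\<lambda>y. ?\<Phi> z (f y)) x = (\<Sum>w\<in>S. ?\<Phi> z w * T (?A w) x)" for x
    proof -
      have "T (\<lambda>y. ?\<Phi> z (f y)) x = T (\<lambda>y. \<Sum>w\<in>S. ?\<Phi> z w * ?A w y) x"
        using simple_function_sum_indicator[OF f(1), of _ "?\<Phi> z"] intA
        by (intro T_cong integrable_simple_function_comp[OF f] Bochner_Integration.integrable_sum)
           (auto simp: S_def)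
      also have "\<dots> = (\<Sum>w\<in>S. ?\<Phi> z w * T (?A w) x)"
        using fin intA by (intro T_sum) auto
      finally show ?thesis .
    qed
    have "F z = (LINT x|N. (\<Sum>v\<in>R. ?\<Phi> z v * ?D v x) * (\<Sum>w\<in>S. ?\<Phi> z w * T (?A w) x))"
      unfolding F_def form_def Tz R_def
      by (intro Bochner_Integration.integral_cong refl arg_cong2[where f = "(*)"]
          simple_function_sum_indicator[OF g(1)]) auto
    also have "\<dots> = (LINT x|N. (\<Sum>v\<in>R. \<Sum>w\<in>S. ?\<Phi> z v * ?\<Phi> z w * (?D v x * T (?A w) x)))"
      by (simp add: sum_product mult_ac)
    also have "\<dots> = (\<Sum>v\<in>R. \<Sum>w\<in>S. ?\<Phi> z v * ?\<Phi> z w * form (?A w) (?D v))"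
      unfolding form_def using intA intD
      by (simp add: Bochner_Integration.integral_sum integrable_T_mult)
    finally show ?thesis .
  qed
  have "norm (F (of_real t)) \<le> C powr (2 / p - 1) * (X powr (1/p) * Y powr (1/p))"
  proof (cases "X * Y > 0")
    case True
    \<comment> \<open>Any finite bound on the strip will do; this one works because the factor 1 -
      Re z / 2 in the exponent of |w| lies between 1/2 and 1.\<close>
    define K where "K = (\<Sum>v\<in>R. \<Sum>w\<in>S. exp (p * \<bar>ln (norm v)\<bar>) * exp (p * \<bar>ln (norm w)\<bar>) * norm (form (?A w) (?D v)))"
    have "norm (F (of_real t)) \<le> (C * (X * Y)) powr (1 - t) * (sqrt (X * Y)) powr t"
    proof (rule three_lines)
      show "F holomorphic_on UNIV"
        unfolding F_eq[abs_def] by (intro holomorphic_intros holomorphic_thorin_family)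
      fix z assume z: "0 \<le> Re z" "Re z \<le> 1"
      have bd: "norm (?\<Phi> z w) \<le> exp (p * \<bar>ln (norm w)\<bar>)" for w
      proof (cases "w = 0")
        case False
        have "(1 - Re z / 2) * ln (norm w) \<le> (1 - Re z / 2) * \<bar>ln (norm w)\<bar>"
          using z by (intro mult_left_mono) auto
        also have "\<dots> \<le> 1 * \<bar>ln (norm w)\<bar>"
          using z by (intro mult_right_mono) auto
        finally have "p * ((1 - Re z / 2) * ln (norm w)) \<le> p * (1 * \<bar>ln (norm w)\<bar>)"
          using p by (intro mult_left_mono) auto
        then show ?thesis using False by (simp add: norm_thorin_family powr_def mult.assoc)
      qed simp
      show "norm (F z) \<le> K"
        unfolding F_eq K_def
        by (intro sum_norm_le) (simp add: norm_mult mult_mono bd)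
    next
      fix z :: complex assume z: "Re z = 0"
      show "norm (F z) \<le> C * (X * Y)"
        using form_bound_L1[OF iF[of z] iG[of z]] unfolding F_def
        by (simp add: norm_thorin_family z X_def Y_def mult.assoc)
    next
      fix z :: complex assume z: "Re z = 1"
      have sq: "(norm (?\<Phi> z w))\<^sup>2 = norm w powr p" for w
        by (simp add: norm_thorin_family z power2_eq_square flip: powr_add)
      show "norm (F z) \<le> sqrt (X * Y)"
        using form_bound_L2[OF iF[of z] _ iG[of z]] unfolding F_def
        by (simp add: sq X_def Y_def intX intY)
    qed (use True t C_pos in auto)
    also have "\<dots> = C powr (1 - t) * ((X * Y) powr (1 - t) * (X * Y) powr (t / 2))"
      using C_pos True X0 Y0 by (simp add: powr_mult powr_powr flip: powr_half_sqrt)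
    also have "\<dots> = C powr (2 / p - 1) * (X * Y) powr (1 / p)"
      using p by (simp flip: powr_add) (simp add: t_def field_simps)
    finally show ?thesis using X0 Y0 by (simp add: powr_mult)
  next
    case False
    \<comment> \<open>\<open>three_lines\<close> asks for positive boundary constants. If X or Y
      vanishes, then f or g is zero almost everywhere, and the L_1 bound already forces the form to
      be 0.\<close>
    then have "X = 0 \<or> Y = 0" using X0 Y0 by (auto simp: mult_pos_pos less_eq_real_def)
    then have zero: "(LINT y|M. norm (f y)) = 0 \<or> (LINT x|N. norm (g x)) = 0"
    proof
      assume "X = 0"
      then have "AE y in M. norm (f y) powr p = 0"
        unfolding X_def using intX by (subst (asm) integral_nonneg_eq_0_iff_AE) auto
      then have "AE y in M. norm (f y) = 0" by eventually_elim auto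
      then show ?thesis using f by (subst integral_nonneg_eq_0_iff_AE) auto
    next
      assume "Y = 0"
      then have "AE y in N. norm (g y) powr p = 0"
        unfolding Y_def using intY by (subst (asm) integral_nonneg_eq_0_iff_AE) auto
      then have "AE y in N. norm (g y) = 0" by eventually_elim auto
      then show ?thesis using g by (subst (2) integral_nonneg_eq_0_iff_AE) auto
    qed
    have "norm (form f g) \<le> 0"
      using form_bound_L1[OF f(2) g(2)] zero by auto
    then show ?thesis using t X0 Y0 by (simp add: F_def thorin_family_real)
  qed
  then show ?thesis
    using t by (simp add: F_def thorin_family_real Lr_norm_def X_def Y_def mult.assoc)
qed

end

section \<open>Simple approximation, Fatou's lemma and almost everywhere convergence in L_r\<close>

lemma Lr_integrable: "f \<in> Lr M r \<Longrightarrow> integrable M (\<lambda>x. norm (f x) powr r)"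
  by (simp add: Lr_def)

text \<open>One sequence has to serve L_1 and L_p at once; the pointwise domination by 2 |f| makes
  dominated convergence available in both.\<close>

lemma simple_function_approximation:
  fixes f :: "'a \<Rightarrow> complex"
  assumes p: "p > 0" and f: "integrable M f" "f \<in> Lr M p"
  obtains s where "\<And>i. simple_function M (s i)" "\<And>i. integrable M (s i)"
    "\<And>x. x \<in> space M \<Longrightarrow> (\<lambda>i. s i x) \<longlonglongrightarrow> f x" "\<And>i x. x \<in> space M \<Longrightarrow> norm (s i x) \<le> 2 * norm (f x)"
    "(\<lambda>i. Lr_norm M p (s i)) \<longlonglongrightarrow> Lr_norm M p f"
proof -
  note [measurable] = borel_measurable_integrable[OF f(1)]
  obtain s where "\<forall>i. simple_function M (s i)" "\<forall>x\<in>space M. (\<lambda>i. s i x) \<longlonglongrightarrow> f x"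
    "\<forall>i. \<forall>x\<in>space M. dist (s i x) 0 \<le> 2 * dist (f x) 0"
    using borel_measurable_implies_sequence_metric[of f M 0] by auto
  then have s: "\<And>i. simple_function M (s i)" "\<And>x. x \<in> space M \<Longrightarrow> (\<lambda>i. s i x) \<longlonglongrightarrow> f x"
    "\<And>i x. x \<in> space M \<Longrightarrow> norm (s i x) \<le> 2 * norm (f x)"
    by auto
  note [measurable] = borel_measurable_simple_function[OF s(1)]
  have int: "integrable M (s i)" for i
    by (rule Bochner_Integration.integrable_bound[OF integrable_mult_right[OF integrable_norm[OF f(1)], of 2]])
      (use s(3) in auto)
  have "(\<lambda>i. LINT x|M. norm (s i x) powr p) \<longlonglongrightarrow> (LINT x|M. norm (f x) powr p)"
  proof (rule integral_dominated_convergence[OF _ _ integrable_mult_right[OF Lr_integrable[OF f(2)], of "2 powr p"]])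
    show "AE x in M. (\<lambda>i. norm (s i x) powr p) \<longlonglongrightarrow> norm (f x) powr p"
      using p by (intro AE_I2 tendsto_powr' tendsto_norm s(2)) auto
    have "norm (s i x) powr p \<le> (2 * norm (f x)) powr p" if "x \<in> space M" for i x
      using p s(3)[OF that] by (intro powr_mono2) auto
    then show "AE x in M. norm (norm (s i x) powr p) \<le> 2 powr p * norm (f x) powr p" for i
      by (intro AE_I2) (auto simp: powr_mult)
  qed simp_all
  then have "(\<lambda>i. Lr_norm M p (s i)) \<longlonglongrightarrow> Lr_norm M p f"
    unfolding Lr_norm_def using p by (intro tendsto_powr') auto
  with s int show ?thesis by (intro that)
qed

text \<open>Fatou's lemma. The bounds may vary with n: they are constant for cut-offs along an
  exhaustion, and convergent for distances to approximants.\<close>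

lemma Lr_limit:
  assumes r: "r > 0" and [measurable]: "g \<in> borel_measurable M"
    and u: "\<And>n. u n \<in> Lr M r" and bound: "\<And>n. Lr_norm M r (u n) \<le> A n" and A: "A \<longlonglongrightarrow> a"
    and lim: "AE x in M. (\<lambda>n. u n x) \<longlonglongrightarrow> g x"
  shows "g \<in> Lr M r" "Lr_norm M r g \<le> a"
proof -
  note [measurable] = Lr_measurable[OF u]
  have A0: "A n \<ge> 0" for n by (rule order_trans[OF Lr_norm_nonneg bound])
  then have a: "a \<ge> 0" by (intro LIMSEQ_le_const[OF A]) auto
  have "(\<integral>\<^sup>+x. ennreal (norm (g x) powr r) \<partial>M) = (\<integral>\<^sup>+x. liminf (\<lambda>n. ennreal (norm (u n x) powr r)) \<partial>M)"
  proof (rule nn_integral_cong_AE)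
    show "AE x in M. ennreal (norm (g x) powr r) = liminf (\<lambda>n. ennreal (norm (u n x) powr r))"
      using lim
    proof eventually_elim
      case (elim x)
      have "(\<lambda>n. ennreal (norm (u n x) powr r)) \<longlonglongrightarrow> ennreal (norm (g x) powr r)"
        using r by (intro tendsto_ennrealI tendsto_powr' tendsto_norm elim) auto
      then show ?case using lim_imp_Liminf[OF trivial_limit_sequentially] by fastforce
    qed
  qed
  also have "\<dots> \<le> liminf (\<lambda>n. \<integral>\<^sup>+x. ennreal (norm (u n x) powr r) \<partial>M)"
    by (rule nn_integral_liminf) simp
  also have "\<dots> = liminf (\<lambda>n. ennreal (Lr_norm M r (u n) powr r))"
    using r u by (simp add: Lr_nn_integral)
  also have "\<dots> \<le> liminf (\<lambda>n. ennreal (A n powr r))"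
    using r by (intro Liminf_mono always_eventually allI ennreal_leI powr_mono2 bound) auto
  also have "\<dots> = ennreal (a powr r)"
    using r a A0 by (intro lim_imp_Liminf tendsto_ennrealI tendsto_powr' A) auto
  finally have "(\<integral>\<^sup>+x. ennreal (norm (g x) powr r) \<partial>M) \<le> ennreal (a powr r)" .
  with r a show "g \<in> Lr M r" "Lr_norm M r g \<le> a" by (auto intro: Lr_nn_integral_le)
qed

text \<open>Pointwise half of the Riesz-Fischer theorem. The rate 4^(-n) leaves room for a weight
  2^n: the r-th powers of the weighted increments have integral at most 2^(-r n), which is
  summable.\<close>

lemma Lr_fast_Cauchy_converges:
  assumes r: "r > 0" and u: "\<And>n. u n \<in> borel_measurable M"
    and d: "\<And>n. (\<lambda>x. u (Suc n) x - u n x) \<in> Lr M r"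
    and bound: "\<And>n. Lr_norm M r (\<lambda>x. u (Suc n) x - u n x) \<le> (1/4) ^ n"
  shows "AE x in M. convergent (\<lambda>n. u n x)"
proof -
  note [measurable] = u
  \<comment> \<open>If the sum of the \<open>v n x\<close> is finite, then the increments at \<open>x\<close> are \<open>O(2\<^sup>-\<^sup>n)\<close>.\<close>
  define v where "v n x = ennreal ((2 ^ n * norm (u (Suc n) x - u n x)) powr r)" for n x
  have v_int: "(\<integral>\<^sup>+x. v n x \<partial>M) \<le> ennreal (((1/2) powr r) ^ n)" for n
  proof -
    have "(\<integral>\<^sup>+x. v n x \<partial>M) = ennreal ((2 ^ n) powr r) * (\<integral>\<^sup>+x. ennreal (norm (u (Suc n) x - u n x) powr r) \<partial>M)"
      unfolding v_def by (simp add: powr_mult ennreal_mult nn_integral_cmult)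
    also have "\<dots> \<le> ennreal ((2 ^ n) powr r) * ennreal (((1/4) ^ n) powr r)"
      using Lr_nn_integral[OF r d] bound r by (auto intro!: mult_left_mono ennreal_leI powr_mono2)
    also have "\<dots> = ennreal ((2 ^ n * (1/4) ^ n) powr r)"
      by (simp add: powr_mult flip: ennreal_mult)
    also have "2 ^ n * (1/4) ^ n = (1/2 :: real) ^ n"
      by (simp flip: power_mult_distrib)
    also have "((1/2 :: real) ^ n) powr r = ((1/2) powr r) ^ n"
      by (simp add: powr_powr mult.commute flip: powr_realpow)
    finally show ?thesis .
  qed
  have "(\<integral>\<^sup>+x. (\<Sum>n. v n x) \<partial>M) = (\<Sum>n. \<integral>\<^sup>+x. v n x \<partial>M)"
    unfolding v_def by (rule nn_integral_suminf) simp
  also have "\<dots> \<le> (\<Sum>n. ennreal (((1/2) powr r) ^ n))"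
    by (intro suminf_le v_int) auto
  also have "\<dots> < \<infinity>"
  proof -
    have "(1/2 :: real) powr r < 1" using powr_less_mono2[of r "1/2" 1] r by simp
    then have "summable (\<lambda>n. ((1/2 :: real) powr r) ^ n)" by (intro summable_geometric) auto
    then show ?thesis by (subst suminf_ennreal2) auto
  qed
  finally have "AE x in M. (\<Sum>n. v n x) \<noteq> \<infinity>"
    by (intro nn_integral_PInf_AE) (auto simp: v_def)
  then show ?thesis
  proof eventually_elim
    case (elim x)
    define S where "S = enn2real (\<Sum>n. v n x)"
    have le: "norm (u (Suc n) x - u n x) \<le> S powr (1 / r) * (1/2) ^ n" for n
    proof -
      have "v n x \<le> (\<Sum>n. v n x)" using sum_le_suminf[of "\<lambda>n. v n x" "{n}"] by simp
      also have "\<dots> = ennreal S" using elim by (simp add: S_def ennreal_enn2real_if)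
      finally have "(2 ^ n * norm (u (Suc n) x - u n x)) powr r \<le> S"
        unfolding v_def by (subst (asm) ennreal_le_iff) (auto simp: S_def)
      then have "((2 ^ n * norm (u (Suc n) x - u n x)) powr r) powr (1/r) \<le> S powr (1/r)"
        using r by (intro powr_mono2) auto
      then show ?thesis using r by (simp add: powr_powr field_simps power_divide)
    qed
    have "summable (\<lambda>n. u (Suc n) x - u n x)"
      by (rule summable_comparison_test'[OF summable_mult[OF summable_geometric[of "1/2::real"]]]) (use le in auto)
    then have "convergent (\<lambda>n. u n x - u 0 x)"
      using sum_lessThan_telescope[of "\<lambda>n. u n x"] by (simp add: summable_iff_convergent)
    then show ?case by (simp add: convergent_diff_const_right_iff)
  qed
qed

lemma conjugate_exponent:
  fixes p q :: real
  assumes "1 < p" "1 / p + 1 / q = 1"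
  shows "q = p / (p - 1)" "q > 1"
proof -
  have "1 / q = (p - 1) / p" using assms by (simp add: diff_divide_distrib)
  then have "1 / (1 / q) = 1 / ((p - 1) / p)" by simp
  then show "q = p / (p - 1)" by simp
  then show "q > 1" using assms(1) by simp
qed

lemma borel_measurable_cnj [measurable]: "cnj \<in> borel_measurable borel"
  by (intro borel_measurable_continuous_onI continuous_intros)

section \<open>The interpolated bound on L_1 \<inter> L_p and its continuous extension to
  L_p\<close>

context L1_L2_operator
begin

text \<open>The L_1 bound does double duty: it gives \<open>T (s i) x\<close> tending to
  \<open>T f x\<close> at each point, and a bound on \<open>T (s i)\<close> uniform in i and x, so
  that a multiple of |g| dominates all integrands.\<close>

lemma form_interpolation:
  assumes p: "1 \<le> p" "p \<le> 2"
    and f: "integrable M f" "f \<in> Lr M p" and g: "integrable N g" "g \<in> Lr N p"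
  shows "norm (form f g) \<le> C powr (2 / p - 1) * Lr_norm M p f * Lr_norm N p g"
proof -
  have p0: "p > 0" using p by simp
  obtain s where s: "\<And>i. simple_function M (s i)" "\<And>i. integrable M (s i)"
    "\<And>x. x \<in> space M \<Longrightarrow> (\<lambda>i. s i x) \<longlonglongrightarrow> f x" "\<And>i x. x \<in> space M \<Longrightarrow> norm (s i x) \<le> 2 * norm (f x)"
    "(\<lambda>i. Lr_norm M p (s i)) \<longlonglongrightarrow> Lr_norm M p f"
    using simple_function_approximation[OF p0 f] by blast
  obtain t where t: "\<And>i. simple_function N (t i)" "\<And>i. integrable N (t i)"
    "\<And>x. x \<in> space N \<Longrightarrow> (\<lambda>i. t i x) \<longlonglongrightarrow> g x" "\<And>i x. x \<in> space N \<Longrightarrow> norm (t i x) \<le> 2 * norm (g x)"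
    "(\<lambda>i. Lr_norm N p (t i)) \<longlonglongrightarrow> Lr_norm N p g"
    using simple_function_approximation[OF p0 g] by blast
  note [measurable] = borel_measurable_integrable[OF f(1)] borel_measurable_integrable[OF s(2)]
    borel_measurable_integrable[OF g(1)] borel_measurable_integrable[OF t(2)]
    T_measurable[OF s(2)] T_measurable[OF f(1)]
  have L1: "(\<lambda>i. LINT y|M. norm (s i y - f y)) \<longlonglongrightarrow> (LINT y|M. 0)"
  proof (rule integral_dominated_convergence[OF _ _ integrable_mult_right[OF integrable_norm[OF f(1)], of 3]])
    show "AE x in M. (\<lambda>i. norm (s i x - f x)) \<longlonglongrightarrow> 0"
      using s(3) by (intro AE_I2) (auto intro: tendsto_norm_zero simp: LIM_zero_iff)
    show "AE x in M. norm (norm (s i x - f x)) \<le> 3 * norm (f x)" for i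
    proof (intro AE_I2)
      fix x assume "x \<in> space M"
      then show "norm (norm (s i x - f x)) \<le> 3 * norm (f x)"
        using s(4)[of x i] norm_triangle_ineq4[of "s i x" "f x"] by simp
    qed
  qed auto
  have Ts: "(\<lambda>i. T (s i) x) \<longlonglongrightarrow> T f x" for x
  proof -
    have "(\<lambda>i. T (s i) x - T f x) \<longlonglongrightarrow> 0"
    proof (rule Lim_null_comparison)
      show "\<forall>\<^sub>F i in sequentially. norm (T (s i) x - T f x) \<le> C * (LINT y|M. norm (s i y - f y))"
        using T_bound[of "\<lambda>y. s _ y - f y" x] s(2) f by (simp add: T_diff)
      show "(\<lambda>i. C * (LINT y|M. norm (s i y - f y))) \<longlonglongrightarrow> 0"
        using tendsto_mult_left[OF L1, of C] by simp
    qed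
    then show ?thesis by (simp add: LIM_zero_iff)
  qed
  have Tbd: "norm (T (s i) x) \<le> C * (2 * (LINT y|M. norm (f y)))" for i x
  proof -
    have "norm (T (s i) x) \<le> C * (LINT y|M. norm (s i y))" by (rule T_bound[OF s(2)])
    also have "\<dots> \<le> C * (LINT y|M. 2 * norm (f y))"
      using C_pos s f by (intro mult_left_mono integral_mono) auto
    finally show ?thesis by simp
  qed
  have "(\<lambda>i. form (s i) (t i)) \<longlonglongrightarrow> form f g"
    unfolding form_def
  proof (rule integral_dominated_convergence[OF _ _ integrable_mult_right[OF integrable_norm[OF g(1)], of "2 * (C * (2 * (LINT y|M. norm (f y))))"]])
    show "AE x in N. (\<lambda>i. t i x * T (s i) x) \<longlonglongrightarrow> g x * T f x"
      by (intro AE_I2 tendsto_mult t(3) Ts)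
    have "norm (t i x) * norm (T (s i) x) \<le> (2 * norm (g x)) * (C * (2 * (LINT y|M. norm (f y))))" if "x \<in> space N" for i x
      using t(4)[OF that] Tbd by (intro mult_mono) auto
    then show "AE x in N. norm (t i x * T (s i) x) \<le> 2 * (C * (2 * (LINT y|M. norm (f y)))) * norm (g x)" for i
      by (intro AE_I2) (simp add: norm_mult mult_ac)
  qed auto
  then have "(\<lambda>i. norm (form (s i) (t i))) \<longlonglongrightarrow> norm (form f g)" by (rule tendsto_norm)
  moreover have "(\<lambda>i. C powr (2 / p - 1) * Lr_norm M p (s i) * Lr_norm N p (t i))
      \<longlonglongrightarrow> C powr (2 / p - 1) * Lr_norm M p f * Lr_norm N p g"
    by (intro tendsto_mult tendsto_const s t)
  ultimately show ?thesis
    by (rule LIMSEQ_le) (use form_interpolation_simple[OF p s(1,2) t(1,2)] in auto)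
qed

text \<open>Converse of Hoelder's inequality. T f is bounded, so on a set of finite measure it lies
  in L_q a priori and can be tested against an integrable function. The resulting bound does not
  depend on the set, and \<open>Lr_limit\<close> removes the cut-off along an exhaustion.\<close>

lemma T_interpolation:
  assumes p: "1 < p" "p \<le> 2" and q: "1 / p + 1 / q = 1"
    and f: "integrable M f" "f \<in> Lr M p"
  shows "T f \<in> Lr N q" "Lr_norm N q (T f) \<le> C powr (2 / p - 1) * Lr_norm M p f"
proof -
  note q_eq = conjugate_exponent(1)[OF p(1) q] and q1 = conjugate_exponent(2)[OF p(1) q]
  \<comment> \<open>This identity makes |g|^p = |h|^q for the test function g below, so that the
    form and the norm of g are expressed by the same integral \<open>Y\<close>.\<close>
  have qp: "(q - 1) * p = q" using p by (simp add: q_eq field_simps)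
  note [measurable] = T_measurable[OF f(1)]
  define B where "B = C powr (2 / p - 1) * Lr_norm M p f"
  have B0: "B \<ge> 0" by (simp add: B_def)
  define h where "h = T f"
  have hm[measurable]: "h \<in> borel_measurable N" by (simp add: h_def)
  define L where "L = C * (LINT y|M. norm (f y))"
  have hL: "norm (h x) \<le> L" for x unfolding h_def L_def by (rule T_bound[OF f(1)])
  have L0: "L \<ge> 0" using C_pos by (simp add: L_def)
  obtain D :: "nat \<Rightarrow> 'b set" where D: "range D \<subseteq> sets N" "(\<Union>i. D i) = space N"
    "\<And>i. emeasure N (D i) \<noteq> \<infinity>" "incseq D"
    using N.sigma_finite_incseq by blast
  have Dm[measurable]: "D i \<in> sets N" for i using D by auto
  have intD: "integrable N (\<lambda>x. indicator (D i) x :: real)" for i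
    using D(3)[of i] by (simp add: integrable_indicator_iff less_top[symmetric])
  have bound: "(\<lambda>x. indicator (D i) x * h x) \<in> Lr N q" "Lr_norm N q (\<lambda>x. indicator (D i) x * h x) \<le> B" for i
  proof -
    \<comment> \<open>the extremal function of Hoelder's inequality, cut off to a set of finite measure\<close>
    define g where "g x = indicator (D i) x * (cnj (sgn (h x)) * of_real (norm (h x) powr (q - 1)))" for x
    have [measurable]: "g \<in> borel_measurable N" unfolding g_def sgn_eq by measurable
    have norm_g: "norm (g x) = indicator (D i) x * norm (h x) powr (q - 1)" for x
      using q1 by (auto simp: g_def norm_mult norm_sgn split: split_indicator)
    have int_g: "integrable N g"
    proof (rule Bochner_Integration.integrable_bound[OF integrable_mult_left[OF intD, where c = "L powr (q - 1)"]])
      show "AE x in N. norm (g x) \<le> norm (indicator (D i) x * L powr (q - 1))"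
        using q1 hL by (auto simp: norm_g powr_mono2 split: split_indicator)
    qed simp
    have g_powr: "norm (g x) powr p = indicator (D i) x * norm (h x) powr q" for x
      using p by (auto simp: norm_g powr_powr qp split: split_indicator)
    have int_hq: "integrable N (\<lambda>x. indicator (D i) x * norm (h x) powr q)"
    proof (rule Bochner_Integration.integrable_bound[OF integrable_mult_left[OF intD, where c = "L powr q"]])
      show "AE x in N. norm (indicator (D i) x * norm (h x) powr q) \<le> norm (indicator (D i) x * L powr q)"
        using q1 hL by (auto simp: powr_mono2 split: split_indicator)
    qed simp
    define Y where "Y = (LINT x|N. indicator (D i) x * norm (h x) powr q)"
    have Y0: "Y \<ge> 0" by (simp add: Y_def)
    have gLr: "g \<in> Lr N p" using int_hq by (simp add: Lr_def g_powr)
    have "form f g = (LINT x|N. of_real (indicator (D i) x * norm (h x) powr q))"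
      unfolding form_def
    proof (rule Bochner_Integration.integral_cong[OF refl])
      fix x
      have "cnj (sgn (h x)) * of_real (norm (h x) powr (q - 1)) * h x = of_real (norm (h x) powr q)"
      proof (cases "h x = 0")
        case False
        have "cnj (sgn (h x)) * h x = of_real (norm (h x))"
          using complex_norm_square[of "h x"] False by (simp add: sgn_eq power2_eq_square mult.commute nonzero_divide_eq_eq)
        then have "cnj (sgn (h x)) * of_real (norm (h x) powr (q - 1)) * h x = of_real (norm (h x) powr (q - 1) * norm (h x) powr 1)"
          by (simp add: mult_ac)
        also have "norm (h x) powr (q - 1) * norm (h x) powr 1 = norm (h x) powr q"
          unfolding powr_add[symmetric] by simp
        finally show ?thesis .
      qed simp
      then show "g x * T f x = of_real (indicator (D i) x * norm (h x) powr q)"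
        by (simp add: g_def h_def[symmetric] mult.assoc split: split_indicator)
    qed
    then have "form f g = of_real Y" by (simp only: Y_def integral_complex_of_real)
    then have "Y \<le> B * Lr_norm N p g"
      using form_interpolation[OF _ p(2) f int_g gLr] p Y0 by (simp add: B_def)
    also have "Lr_norm N p g = Y powr (1 / p)" by (simp add: Lr_norm_def g_powr Y_def)
    finally have Yle: "Y \<le> B * Y powr (1 / p)" .
    \<comment> \<open>\<open>Y\<close> is finite thanks to the cut-off, so unless it is 0 the
      inequality \<open>Yle\<close> may be divided by \<open>Y powr (1 / p)\<close>, which leaves
      \<open>Y powr (1 / q) \<le> B\<close>.\<close>
    have "Y \<le> B powr q"
    proof (cases "Y = 0")
      case False
      then have "Y > 0" using Y0 by simp
      have "1 / q = 1 - 1 / p" using q by linarith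
      then have "Y powr (1 / q) = Y powr (1 - 1 / p)" by simp
      also have "\<dots> = Y / Y powr (1 / p)" using \<open>Y > 0\<close> by (simp add: powr_diff)
      also have "\<dots> \<le> B" using Yle \<open>Y > 0\<close> by (simp add: pos_divide_le_eq)
      finally have "(Y powr (1 / q)) powr q \<le> B powr q" using q1 by (intro powr_mono2) auto
      then show ?thesis using q1 \<open>Y > 0\<close> by (simp add: powr_powr)
    qed simp
    moreover have "norm (indicator (D i) x * h x) powr q = indicator (D i) x * norm (h x) powr q" for x
      using q1 by (auto split: split_indicator)
    ultimately show "(\<lambda>x. indicator (D i) x * h x) \<in> Lr N q" "Lr_norm N q (\<lambda>x. indicator (D i) x * h x) \<le> B"
      using int_hq q1 B0 by (auto simp: Lr_def Lr_norm_le_iff Y_def)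
  qed
  have lim: "AE x in N. (\<lambda>i. indicator (D i) x * h x) \<longlonglongrightarrow> h x"
  proof (intro AE_I2)
    fix x assume "x \<in> space N"
    then have "(\<lambda>i. indicator (D i) x :: complex) \<longlonglongrightarrow> 1"
      using LIMSEQ_indicator_incseq[OF D(4), of x] D(2) by simp
    then show "(\<lambda>i. indicator (D i) x * h x) \<longlonglongrightarrow> h x"
      using tendsto_mult_right[of _ 1 sequentially "h x"] by fastforce
  qed
  show "T f \<in> Lr N q" "Lr_norm N q (T f) \<le> C powr (2 / p - 1) * Lr_norm M p f"
    using Lr_limit[OF _ hm bound tendsto_const lim] q1 by (simp_all add: h_def B_def)
qed

text \<open>The limit g is described by its distance to every \<open>T h\<close>, not by the
  sequence that produced it; the limits for two different functions can then be compared through any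
  common \<open>T h\<close>.\<close>

lemma extension_exists:
  assumes p: "1 < p" "p \<le> 2" and q: "1 / p + 1 / q = 1" and f: "f \<in> Lr M p"
  obtains g where "g \<in> Lr N q"
    "\<And>h. integrable M h \<Longrightarrow> h \<in> Lr M p \<Longrightarrow>
       Lr_norm N q (\<lambda>x. T h x - g x) \<le> C powr (2 / p - 1) * Lr_norm M p (\<lambda>y. h y - f y)"
proof -
  note q1 = conjugate_exponent(2)[OF p(1) q]
  have p1: "p \<ge> 1" using p by simp
  define B where "B = C powr (2 / p - 1)"
  have B: "B > 0" using C_pos by (simp add: B_def)
  obtain F where F: "\<And>n. F n \<in> Lr M p" "\<And>n. integrable M (F n)"
    "(\<lambda>n. Lr_norm M p (\<lambda>x. F n x - f x)) \<longlonglongrightarrow> 0"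
    using Lr_dense[OF p1 f] by blast
  \<comment> \<open>After applying \<open>T\<close>, consecutive terms differ by at most B *
    (4^(-n-1) + 4^(-n)) / (2 * B), which is below the 4^(-n) that
    \<open>Lr_fast_Cauchy_converges\<close> asks for.\<close>
  have "\<exists>k. Lr_norm M p (\<lambda>x. F k x - f x) \<le> (1/4) ^ n / (2 * B)" for n
  proof -
    have "eventually (\<lambda>k. Lr_norm M p (\<lambda>x. F k x - f x) < (1/4) ^ n / (2 * B)) sequentially"
      using B by (intro order_tendstoD[OF F(3)]) auto
    then show ?thesis by (auto simp: eventually_sequentially intro: less_imp_le)
  qed
  then obtain k where k: "\<And>n. Lr_norm M p (\<lambda>x. F (k n) x - f x) \<le> (1/4) ^ n / (2 * B)" by metis
  define G where "G n = F (k n)" for n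
  have G: "G n \<in> Lr M p" "integrable M (G n)" for n by (simp_all add: G_def F)
  have Gf: "(\<lambda>x. G n x - f x) \<in> Lr M p" "(\<lambda>x. f x - G n x) \<in> Lr M p" for n
    using Minkowski_diff[OF p1 G(1) f] Minkowski_diff[OF p1 f G(1)] by auto
  have T_diff_bound: "(\<lambda>x. T h x - T h' x) \<in> Lr N q" "Lr_norm N q (\<lambda>x. T h x - T h' x) \<le> B * Lr_norm M p (\<lambda>y. h y - h' y)"
    if "integrable M h" "h \<in> Lr M p" "integrable M h'" "h' \<in> Lr M p" for h h'
  proof -
    have "T (\<lambda>y. h y - h' y) = (\<lambda>x. T h x - T h' x)" using that by (simp add: T_diff fun_eq_iff)
    then show "(\<lambda>x. T h x - T h' x) \<in> Lr N q" "Lr_norm N q (\<lambda>x. T h x - T h' x) \<le> B * Lr_norm M p (\<lambda>y. h y - h' y)"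
      using T_interpolation[OF p q, of "\<lambda>y. h y - h' y"] Minkowski_diff(1)[OF p1 that(2,4)] that
      by (simp_all add: B_def)
  qed
  have step: "Lr_norm N q (\<lambda>x. T (G (Suc n)) x - T (G n) x) \<le> (1/4) ^ n" for n
  proof -
    have "Lr_norm N q (\<lambda>x. T (G (Suc n)) x - T (G n) x) \<le> B * Lr_norm M p (\<lambda>y. G (Suc n) y - G n y)"
      by (rule T_diff_bound(2)) (use G in auto)
    also have "\<dots> \<le> B * (Lr_norm M p (\<lambda>y. G (Suc n) y - f y) + Lr_norm M p (\<lambda>y. f y - G n y))"
      using B by (intro mult_left_mono Minkowski_triangle[OF p1] Gf) auto
    also have "\<dots> \<le> B * ((1/4) ^ Suc n / (2 * B) + (1/4) ^ n / (2 * B))"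
      using B k[of "Suc n"] k[of n] by (intro mult_left_mono add_mono)
        (auto simp: G_def Lr_norm_minus_commute[of M p f])
    also have "\<dots> \<le> (1/4) ^ n" using B by (simp add: field_simps)
    finally show ?thesis .
  qed
  have conv: "AE x in N. convergent (\<lambda>n. T (G n) x)"
    by (rule Lr_fast_Cauchy_converges[OF _ _ _ step])
      (use q1 G T_measurable T_diff_bound(1) in auto)
  define g where "g x = lim (\<lambda>n. T (G n) x)" for x
  note [measurable] = T_measurable[OF G(2)]
  have gm[measurable]: "g \<in> borel_measurable N" unfolding g_def by measurable
  have lim: "AE x in N. (\<lambda>n. T (G n) x) \<longlonglongrightarrow> g x"
    using conv by eventually_elim (simp add: g_def convergent_LIMSEQ_iff)
  have Glim: "(\<lambda>n. Lr_norm M p (\<lambda>y. G n y - f y)) \<longlonglongrightarrow> 0"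
  proof (rule Lim_null_comparison)
    show "\<forall>\<^sub>F n in sequentially. norm (Lr_norm M p (\<lambda>y. G n y - f y)) \<le> (1/4) ^ n / (2 * B)"
      using k by (simp add: G_def)
    show "(\<lambda>n. (1/4) ^ n / (2 * B)) \<longlonglongrightarrow> 0"
      by (intro tendsto_divide_zero LIMSEQ_power_zero) auto
  qed
  have main: "(\<lambda>x. T h x - g x) \<in> Lr N q \<and> Lr_norm N q (\<lambda>x. T h x - g x) \<le> B * Lr_norm M p (\<lambda>y. h y - f y)"
    if h: "integrable M h" "h \<in> Lr M p" for h
  proof -
    note [measurable] = T_measurable[OF h(1)]
    define A where "A n = B * (Lr_norm M p (\<lambda>y. h y - f y) + Lr_norm M p (\<lambda>y. G n y - f y))" for n
    have A: "A \<longlonglongrightarrow> B * (Lr_norm M p (\<lambda>y. h y - f y) + 0)"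
      unfolding A_def by (intro tendsto_intros Glim)
    have le: "Lr_norm N q (\<lambda>x. T h x - T (G n) x) \<le> A n" for n
    proof -
      have "Lr_norm N q (\<lambda>x. T h x - T (G n) x) \<le> B * Lr_norm M p (\<lambda>y. h y - G n y)"
        by (rule T_diff_bound(2)) (use h G in auto)
      also have "\<dots> \<le> B * (Lr_norm M p (\<lambda>y. h y - f y) + Lr_norm M p (\<lambda>y. f y - G n y))"
        using B h by (intro mult_left_mono Minkowski_triangle[OF p1] Gf Minkowski_diff(1)[OF p1 _ f]) auto
      finally show ?thesis by (simp add: A_def Lr_norm_minus_commute[of M p f])
    qed
    have "AE x in N. (\<lambda>n. T h x - T (G n) x) \<longlonglongrightarrow> T h x - g x"
      using lim by eventually_elim (intro tendsto_intros)
    then show ?thesis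
      using Lr_limit[OF _ _ T_diff_bound(1)[OF h G(2) G(1)] le A] q1 by auto
  qed
  \<comment> \<open>Taking h = 0 in \<open>main\<close> turns the distance estimate into membership
    of -g, hence of g.\<close>
  have zero: "(\<lambda>_. 0) \<in> Lr M p" by (simp add: Lr_def)
  have "T (\<lambda>_. 0) x = 0" for x using T_mult[of "\<lambda>_. 0" 0 x] by simp
  then have "(\<lambda>x. - g x) \<in> Lr N q" using main[OF _ zero] by simp
  then have "g \<in> Lr N q" by (simp add: Lr_uminus)
  then show ?thesis using main that by (auto simp: B_def)
qed

lemma continuous_extension_exists:
  assumes p: "1 < p" "p \<le> 2" and q: "1 / p + 1 / q = 1"
  obtains T' where "\<And>f. f \<in> Lr M p \<Longrightarrow> T' f \<in> Lr N q"
    "\<And>f. integrable M f \<Longrightarrow> f \<in> Lr M p \<Longrightarrow> T' f = T f"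
    "\<And>f g. f \<in> Lr M p \<Longrightarrow> g \<in> Lr M p \<Longrightarrow>
       Lr_norm N q (\<lambda>x. T' f x - T' g x) \<le> C powr (2 / p - 1) * Lr_norm M p (\<lambda>y. f y - g y)"
proof -
  note q1 = conjugate_exponent(2)[OF p(1) q]
  have p1: "p \<ge> 1" using p by simp
  define B where "B = C powr (2 / p - 1)"
  have B: "B \<ge> 0" by (simp add: B_def)
  define P where "P f g \<longleftrightarrow> g \<in> Lr N q \<and> (\<forall>h. integrable M h \<longrightarrow> h \<in> Lr M p \<longrightarrow>
      Lr_norm N q (\<lambda>x. T h x - g x) \<le> B * Lr_norm M p (\<lambda>y. h y - f y))" for f g
  \<comment> \<open>Taking \<open>T f\<close> outright for integrable f secures agreement at every
    point; the property \<open>P\<close> alone would fix the value only up to a null set.\<close>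
  define T' where "T' f = (if integrable M f then T f else (SOME g. P f g))" for f
  have T': "P f (T' f)" if f: "f \<in> Lr M p" for f
  proof (cases "integrable M f")
    case True
    have "Lr_norm N q (\<lambda>x. T h x - T f x) \<le> B * Lr_norm M p (\<lambda>y. h y - f y)"
      if h: "integrable M h" "h \<in> Lr M p" for h
    proof -
      have "T (\<lambda>y. h y - f y) = (\<lambda>x. T h x - T f x)" using h True by (simp add: T_diff fun_eq_iff)
      then show ?thesis
        using T_interpolation(2)[OF p q, of "\<lambda>y. h y - f y"] Minkowski_diff(1)[OF p1 h(2) f] h True
        by (simp add: B_def)
    qed
    then show ?thesis using T_interpolation(1)[OF p q True f] True by (simp add: P_def T'_def)
  next
    case False
    have "\<exists>g. P f g" using extension_exists[OF p q f] unfolding P_def B_def by metis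
    then show ?thesis using False by (simp add: T'_def someI_ex[of "P f"])
  qed
  have in_Lr: "T' f \<in> Lr N q" if "f \<in> Lr M p" for f using T'[OF that] by (simp add: P_def)
  show ?thesis
  proof (rule that[of T'])
    show "T' f = T f" if "integrable M f" for f using that by (simp add: T'_def)
  next
    fix f g assume f: "f \<in> Lr M p" and g: "g \<in> Lr M p"
    \<comment> \<open>The choices behind \<open>T'\<close> are made separately for each function, so
      linearity is not at hand. \<open>T' f\<close> and \<open>T' g\<close> are compared through
      \<open>T (F n)\<close>, with \<open>F n\<close> approximating f alone; the terms in
      \<open>F n - f\<close> vanish in the limit.\<close>
    obtain F where F: "\<And>n. F n \<in> Lr M p" "\<And>n. integrable M (F n)"
      "(\<lambda>n. Lr_norm M p (\<lambda>x. F n x - f x)) \<longlonglongrightarrow> 0"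
      using Lr_dense[OF p1 f] by blast
    have "Lr_norm N q (\<lambda>x. T' f x - T' g x) \<le> B * (Lr_norm M p (\<lambda>x. F n x - f x) + (Lr_norm M p (\<lambda>x. F n x - f x) + Lr_norm M p (\<lambda>x. f x - g x)))" for n
    proof -
      have TF: "T (F n) \<in> Lr N q" using T_interpolation(1)[OF p q F(2) F(1)] .
      have "Lr_norm N q (\<lambda>x. T' f x - T' g x) \<le> Lr_norm N q (\<lambda>x. T' f x - T (F n) x) + Lr_norm N q (\<lambda>x. T (F n) x - T' g x)"
        using q1 f g TF by (intro Minkowski_triangle Minkowski_diff(1) in_Lr) auto
      also have "Lr_norm N q (\<lambda>x. T' f x - T (F n) x) \<le> B * Lr_norm M p (\<lambda>x. F n x - f x)"
        using T'[OF f] F by (simp add: P_def Lr_norm_minus_commute[of N q "T' f"])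
      also have "Lr_norm N q (\<lambda>x. T (F n) x - T' g x) \<le> B * Lr_norm M p (\<lambda>x. F n x - g x)"
        using T'[OF g] F by (simp add: P_def)
      also have "Lr_norm M p (\<lambda>x. F n x - g x) \<le> Lr_norm M p (\<lambda>x. F n x - f x) + Lr_norm M p (\<lambda>x. f x - g x)"
        using F f g by (intro Minkowski_triangle[OF p1] Minkowski_diff(1)[OF p1]) auto
      finally show ?thesis using B by (simp add: distrib_left mult_left_mono)
    qed
    moreover have "(\<lambda>n. B * (Lr_norm M p (\<lambda>x. F n x - f x) + (Lr_norm M p (\<lambda>x. F n x - f x) + Lr_norm M p (\<lambda>x. f x - g x))))
      \<longlonglongrightarrow> B * (0 + (0 + Lr_norm M p (\<lambda>x. f x - g x)))"
      by (intro tendsto_intros F(3))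
    ultimately show "Lr_norm N q (\<lambda>x. T' f x - T' g x) \<le> C powr (2 / p - 1) * Lr_norm M p (\<lambda>y. f y - g y)"
      by (intro LIMSEQ_le_const) (auto simp: B_def)
  qed (rule in_Lr)
qed

text \<open>Stated for an arbitrary extension because the choice operator may select another one
  than that constructed. Approximating f by integrable \<open>F n\<close>, the triangle inequality
  combines agreement at \<open>F n\<close> with continuity at f.\<close>

lemma continuous_extension_bound:
  assumes p: "1 < p" "p \<le> 2" and q: "1 / p + 1 / q = 1"
    and range: "\<And>f. f \<in> Lr M p \<Longrightarrow> T' f \<in> Lr N q"
    and agrees: "\<And>f. integrable M f \<Longrightarrow> f \<in> Lr M p \<Longrightarrow> T' f = T f"
    and cont: "\<And>F f. (\<And>n. F n \<in> Lr M p) \<Longrightarrow> f \<in> Lr M p \<Longrightarrow>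
      (\<lambda>n. Lr_norm M p (\<lambda>y. F n y - f y)) \<longlonglongrightarrow> 0 \<Longrightarrow> (\<lambda>n. Lr_norm N q (\<lambda>x. T' (F n) x - T' f x)) \<longlonglongrightarrow> 0"
    and f: "f \<in> Lr M p"
  shows "Lr_norm N q (T' f) \<le> C powr (2 / p - 1) * Lr_norm M p f"
proof -
  have q1: "q \<ge> 1" and p1: "p \<ge> 1" using conjugate_exponent(2)[OF p(1) q] p by auto
  define B where "B = C powr (2 / p - 1)"
  have B: "B \<ge> 0" by (simp add: B_def)
  obtain F where F: "\<And>n. F n \<in> Lr M p" "\<And>n. integrable M (F n)"
    "(\<lambda>n. Lr_norm M p (\<lambda>x. F n x - f x)) \<longlonglongrightarrow> 0"
    using Lr_dense[OF p1 f] by blast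
  let ?A = "\<lambda>n. B * (Lr_norm M p (\<lambda>x. F n x - f x) + Lr_norm M p f) + Lr_norm N q (\<lambda>x. T' (F n) x - T' f x)"
  have "Lr_norm N q (T' f) \<le> ?A n" for n
  proof -
    have "Lr_norm N q (T' f) = Lr_norm N q (\<lambda>x. T' (F n) x - (T' (F n) x - T' f x))" by simp
    also have "\<dots> \<le> Lr_norm N q (T' (F n)) + Lr_norm N q (\<lambda>x. T' (F n) x - T' f x)"
      by (intro Minkowski_diff[OF q1] range f F)
    also have "Lr_norm N q (T' (F n)) \<le> B * Lr_norm M p (F n)"
      using T_interpolation(2)[OF p q F(2) F(1)] by (simp add: agrees F B_def)
    also have "Lr_norm M p (F n) = Lr_norm M p (\<lambda>x. (F n x - f x) + f x)" by simp
    also have "\<dots> \<le> Lr_norm M p (\<lambda>x. F n x - f x) + Lr_norm M p f"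
      by (intro Minkowski[OF p1] Minkowski_diff(1)[OF p1] f F)
    finally show ?thesis using B by (simp add: mult_left_mono)
  qed
  moreover have "?A \<longlonglongrightarrow> B * (0 + Lr_norm M p f) + 0"
    by (intro tendsto_intros F(3) cont F(1) f)
  ultimately show ?thesis by (intro LIMSEQ_le_const) (auto simp: B_def)
qed

end

section \<open>The \<open>L\<^sub>2\<close> bound for the Fourier integral\<close>

lemma sigma_finite_completion:
  assumes "sigma_finite_measure M"
  shows "sigma_finite_measure (completion M)"
proof -
  interpret sigma_finite_measure M by fact
  obtain A where "countable A" "A \<subseteq> sets M" "\<Union>A = space M" "\<forall>a\<in>A. emeasure M a \<noteq> \<infinity>"
    using sigma_finite_countable by blast
  then show ?thesis
    by (intro sigma_finite_measure.intro exI[of _ A]) auto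
qed

interpretation lebesgue: sigma_finite_measure "lebesgue :: 'a::euclidean_space measure"
  by (intro sigma_finite_completion sigma_finite_lborel)

interpretation lebesgue_pair: pair_sigma_finite "lebesgue :: real measure" "lebesgue :: real measure" ..

text \<open>The characteristic function of the standard normal law at u / \<sigma>, after the
  substitution s = \<sigma> b \<xi> with Jacobian |\<sigma> b|. As a function of u the result has
  mass 2 pi / |b| for every \<sigma>, so the estimate built on it survives \<sigma> tending to
  0.\<close>

lemma fourier_gaussian:
  fixes b \<sigma> u :: real
  assumes "b \<noteq> 0" "\<sigma> > 0"
  shows "(LINT \<xi>|lebesgue. of_real (exp (- (\<sigma> * b * \<xi>)\<^sup>2 / 2)) * exp (\<i> * of_real (b * \<xi> * u))) =
    complex_of_real (2 * pi / \<bar>b\<bar> * normal_density 0 \<sigma> u)"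
proof -
  have "char std_normal_distribution (u / \<sigma>) = of_real (exp (- (u / \<sigma>)\<^sup>2 / 2))"
    by (simp add: char_std_normal_distribution)
  moreover have "char std_normal_distribution (u / \<sigma>) =
      (LINT s|lborel. std_normal_density s *\<^sub>R iexp (u / \<sigma> * s))"
    unfolding char_def by (subst integral_density) auto
  ultimately have "(LINT s|lborel. std_normal_density s *\<^sub>R iexp (u / \<sigma> * s)) = of_real (exp (- (u / \<sigma>)\<^sup>2 / 2))"
    by simp
  also have "(LINT s|lborel. std_normal_density s *\<^sub>R iexp (u / \<sigma> * s)) =
     \<bar>\<sigma> * b\<bar> *\<^sub>R (LINT \<xi>|lborel. std_normal_density (0 + \<sigma> * b * \<xi>) *\<^sub>R iexp (u / \<sigma> * (0 + \<sigma> * b * \<xi>)))"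
    using assms by (intro lborel_integral_real_affine) auto
  also have "(LINT \<xi>|lborel. std_normal_density (0 + \<sigma> * b * \<xi>) *\<^sub>R iexp (u / \<sigma> * (0 + \<sigma> * b * \<xi>))) =
     (LINT \<xi>|lborel. of_real (1 / sqrt (2 * pi)) * (of_real (exp (- (\<sigma> * b * \<xi>)\<^sup>2 / 2)) * exp (\<i> * of_real (b * \<xi> * u))))"
    using assms by (intro Bochner_Integration.integral_cong refl)
      (simp add: std_normal_density_def scaleR_conv_of_real mult_ac)
  also have "\<dots> = of_real (1 / sqrt (2 * pi)) * (LINT \<xi>|lborel. of_real (exp (- (\<sigma> * b * \<xi>)\<^sup>2 / 2)) * exp (\<i> * of_real (b * \<xi> * u)))"
    by simp
  also have "(LINT \<xi>|lborel. of_real (exp (- (\<sigma> * b * \<xi>)\<^sup>2 / 2)) * exp (\<i> * of_real (b * \<xi> * u))) =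
     (LINT \<xi>|lebesgue. of_real (exp (- (\<sigma> * b * \<xi>)\<^sup>2 / 2)) * exp (\<i> * of_real (b * \<xi> * u)))" (is "_ = ?I")
    by (rule integral_completion[symmetric]) measurable
  finally have "of_real (\<bar>\<sigma> * b\<bar> / sqrt (2 * pi)) * ?I = of_real (exp (- (u / \<sigma>)\<^sup>2 / 2))"
    by (simp add: scaleR_conv_of_real mult.assoc)
  then have "of_real (sqrt (2 * pi) / \<bar>\<sigma> * b\<bar>) * (of_real (\<bar>\<sigma> * b\<bar> / sqrt (2 * pi)) * ?I) =
     of_real (sqrt (2 * pi) / \<bar>\<sigma> * b\<bar>) * of_real (exp (- (u / \<sigma>)\<^sup>2 / 2))"
    by simp
  moreover have "of_real (sqrt (2 * pi) / \<bar>\<sigma> * b\<bar>) * (of_real (\<bar>\<sigma> * b\<bar> / sqrt (2 * pi)) * ?I) = ?I"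
  proof -
    have "sqrt (2 * pi) / \<bar>\<sigma> * b\<bar> * (\<bar>\<sigma> * b\<bar> / sqrt (2 * pi)) = 1" using assms by simp
    then show ?thesis by (simp only: mult.assoc[symmetric] of_real_mult[symmetric] of_real_1 mult_1)
  qed
  moreover have "sqrt (2 * pi) / \<bar>\<sigma> * b\<bar> * exp (- (u / \<sigma>)\<^sup>2 / 2) = 2 * pi / \<bar>b\<bar> * normal_density 0 \<sigma> u"
    using assms
    by (simp add: normal_density_def abs_mult real_sqrt_mult power_divide real_div_sqrt field_simps)
  ultimately show ?thesis by (simp only: of_real_mult[symmetric])
qed

definition fourier_kernel_integral :: "real \<Rightarrow> (real \<Rightarrow> complex) \<Rightarrow> real \<Rightarrow> complex" where
  "fourier_kernel_integral b f \<xi> = (LINT y|lebesgue. exp (- \<i> * of_real (b * \<xi> * y)) * f y)"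

lemma borel_measurable_lebesgue_id [measurable]: "(\<lambda>x. x) \<in> borel_measurable (lebesgue :: 'a::euclidean_space measure)"
  by (rule measurable_completion) simp

lemma lebesgue_pair_fst [measurable]: "fst \<in> borel_measurable ((lebesgue :: real measure) \<Otimes>\<^sub>M (lebesgue :: real measure))"
  by (rule measurable_compose[OF measurable_fst borel_measurable_lebesgue_id])

lemma lebesgue_pair_snd [measurable]: "snd \<in> borel_measurable ((lebesgue :: real measure) \<Otimes>\<^sub>M (lebesgue :: real measure))"
  by (rule measurable_compose[OF measurable_snd borel_measurable_lebesgue_id])

lemma norm_fourier_factor [simp]: "norm (exp (- (\<i> * complex_of_real t))) = 1" "norm (exp (\<i> * complex_of_real t)) = 1"
  using norm_exp_i_times[of "-t"] by auto

lemma borel_measurable_fourier_kernel_integral [measurable]: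
  assumes "f \<in> borel_measurable lebesgue"
  shows "fourier_kernel_integral b f \<in> borel_measurable lebesgue"
proof -
  note [measurable] = assms measurable_compose[OF measurable_snd assms]
  show ?thesis
    unfolding fourier_kernel_integral_def[abs_def] by measurable
qed

lemma norm_fourier_kernel_integral_le:
  assumes "integrable lebesgue f"
  shows "norm (fourier_kernel_integral b f \<xi>) \<le> (LINT y|lebesgue. norm (f y))"
  unfolding fourier_kernel_integral_def
  by (rule order_trans[OF integral_norm_bound]) (simp add: norm_mult)

text \<open>Licenses both exchanges of integrals in the weighted estimate, where the kernels are
  unimodular and the other factor is a product of integrable functions of one variable each.\<close>

lemma integrable_product_bound:
  fixes g h :: "real \<Rightarrow> complex" and k :: "real \<Rightarrow> real \<Rightarrow> complex"
  assumes g: "integrable lebesgue g" and h: "integrable lebesgue h"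
    and [measurable]: "case_prod k \<in> borel_measurable (lebesgue \<Otimes>\<^sub>M lebesgue)"
    and k: "\<And>x y. norm (k x y) \<le> B"
  shows "integrable (lebesgue \<Otimes>\<^sub>M lebesgue) (\<lambda>(x, y). k x y * (g x * h y))"
proof (rule lebesgue_pair.Fubini_integrable)
  note gm[measurable] = measurable_compose[OF measurable_fst borel_measurable_integrable[OF g]]
  note hm[measurable] = measurable_compose[OF measurable_snd borel_measurable_integrable[OF h]]
  have [measurable]: "(\<lambda>p. k (fst p) (snd p)) \<in> borel_measurable (lebesgue \<Otimes>\<^sub>M lebesgue)"
    using assms(3) by (simp add: case_prod_beta')
  show meas: "(\<lambda>(x, y). k x y * (g x * h y)) \<in> borel_measurable (lebesgue \<Otimes>\<^sub>M lebesgue)"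
    unfolding case_prod_beta' by measurable
  have B: "B \<ge> 0" using k[of 0 0] norm_ge_zero order_trans by blast
  have sec[measurable]: "(\<lambda>y. k x y) \<in> borel_measurable lebesgue" for x
    using measurable_Pair2[OF assms(3), of x] by simp
  have inth: "integrable lebesgue (\<lambda>y. k x y * (g x * h y))" for x
  proof (rule Bochner_Integration.integrable_bound[OF integrable_mult_right[OF integrable_norm[OF h], of "B * norm (g x)"]])
    show "AE y in lebesgue. norm (k x y * (g x * h y)) \<le> norm (B * norm (g x) * norm (h y))"
      using k B by (intro AE_I2) (simp add: norm_mult mult.assoc mult_right_mono)
  qed (use borel_measurable_integrable[OF h] in measurable)
  then show "AE x in lebesgue. integrable lebesgue (\<lambda>y. case (x, y) of (x, y) \<Rightarrow> k x y * (g x * h y))"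
    by simp
  show "integrable lebesgue (\<lambda>x. LINT y|lebesgue. norm (case (x, y) of (x, y) \<Rightarrow> k x y * (g x * h y)))"
  proof (rule Bochner_Integration.integrable_bound[OF integrable_mult_left[OF integrable_norm[OF g], of "B * (LINT y|lebesgue. norm (h y))"]])
    show "(\<lambda>x. LINT y|lebesgue. norm (case (x, y) of (x, y) \<Rightarrow> k x y * (g x * h y))) \<in> borel_measurable lebesgue"
      using meas by (intro lebesgue.borel_measurable_lebesgue_integral) measurable
    have "(LINT y|lebesgue. norm (k x y * (g x * h y))) \<le> norm (g x) * (B * (LINT y|lebesgue. norm (h y)))" for x
    proof -
      have "(LINT y|lebesgue. norm (k x y * (g x * h y))) \<le> (LINT y|lebesgue. norm (g x) * (B * norm (h y)))"
        using h inth k B by (intro integral_mono integrable_norm integrable_mult_right)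
          (auto simp: norm_mult intro!: mult_right_mono mult_left_mono simp flip: mult.assoc simp: mult.commute[of _ "norm (g x)"])
      then show ?thesis by simp
    qed
    then show "AE x in lebesgue. norm (LINT y|lebesgue. norm (case (x, y) of (x, y) \<Rightarrow> k x y * (g x * h y)))
        \<le> norm (norm (g x) * (B * (LINT y|lebesgue. norm (h y))))"
      using B by (intro AE_I2) (simp add: abs_mult)
  qed
qed

lemma nn_integral_normal_density_shift:
  assumes "\<sigma> > 0"
  shows "(\<integral>\<^sup>+y. ennreal (normal_density 0 \<sigma> (y - x)) \<partial>lebesgue) = 1"
    and "(\<integral>\<^sup>+y. ennreal (normal_density 0 \<sigma> (x - y)) \<partial>lebesgue) = 1"
proof -
  have eq: "normal_density 0 \<sigma> (y - x) = normal_density x \<sigma> y" "normal_density 0 \<sigma> (x - y) = normal_density x \<sigma> y" for y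
    by (simp_all add: normal_density_def power2_commute)
  have "(\<integral>\<^sup>+y. ennreal (normal_density x \<sigma> y) \<partial>lebesgue) = 1"
    using assms by (simp add: nn_integral_completion nn_integral_eq_integral)
  then show "(\<integral>\<^sup>+y. ennreal (normal_density 0 \<sigma> (y - x)) \<partial>lebesgue) = 1"
    "(\<integral>\<^sup>+y. ennreal (normal_density 0 \<sigma> (x - y)) \<partial>lebesgue) = 1"
    by (simp_all add: eq)
qed

text \<open>Schur's test: 2 |f(x) f(y)| \<le> |f(x)|^2 + |f(y)|^2, and the kernel has mass 1 in each
  variable separately, so each half contributes half of the squared norm.\<close>

lemma gaussian_quadratic_form_le:
  fixes f :: "real \<Rightarrow> complex"
  assumes \<sigma>: "\<sigma> > 0" and [measurable]: "f \<in> borel_measurable lebesgue" and sq: "integrable lebesgue (\<lambda>y. (norm (f y))\<^sup>2)"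
  shows "(\<integral>\<^sup>+x. \<integral>\<^sup>+y. ennreal (norm (f x) * norm (f y) * normal_density 0 \<sigma> (y - x)) \<partial>lebesgue \<partial>lebesgue)
    \<le> ennreal (LINT y|lebesgue. (norm (f y))\<^sup>2)"
proof -
  let ?\<kappa> = "\<lambda>x y. normal_density 0 \<sigma> (y - x)"
  let ?S = "ennreal (LINT y|lebesgue. (norm (f y))\<^sup>2)"
  note [measurable] = measurable_compose[OF measurable_fst assms(2)] measurable_compose[OF measurable_snd assms(2)]
  have S: "(\<integral>\<^sup>+x. ennreal ((norm (f x))\<^sup>2) \<partial>lebesgue) = ?S"
    using sq by (simp add: nn_integral_eq_integral)
  have combine: "ennreal r \<le> ennreal h * (ennreal u * ennreal k) + ennreal h * (ennreal v * ennreal k)"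
    if "r \<le> h * (u * k) + h * (v * k)" "0 \<le> h" "0 \<le> u" "0 \<le> v" "0 \<le> k" for r h u v k :: real
    using ennreal_leI[OF that(1)] that by (simp add: ennreal_mult ennreal_plus)
  have half: "ennreal (1/2) + ennreal (1/2) = 1"
    by (subst ennreal_plus[symmetric]) auto
  have "(\<integral>\<^sup>+x. \<integral>\<^sup>+y. ennreal (norm (f x) * norm (f y) * ?\<kappa> x y) \<partial>lebesgue \<partial>lebesgue)
    \<le> (\<integral>\<^sup>+x. \<integral>\<^sup>+y. ennreal (1/2) * (ennreal ((norm (f x))\<^sup>2) * ennreal (?\<kappa> x y)) + ennreal (1/2) * (ennreal ((norm (f y))\<^sup>2) * ennreal (?\<kappa> x y)) \<partial>lebesgue \<partial>lebesgue)"
  proof (intro nn_integral_mono)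
    fix x y
    have "2 * (norm (f x) * norm (f y)) \<le> (norm (f x))\<^sup>2 + (norm (f y))\<^sup>2"
      using sum_squares_bound[of "norm (f x)" "norm (f y)"] by simp
    then have "norm (f x) * norm (f y) * ?\<kappa> x y \<le> ((norm (f x))\<^sup>2 + (norm (f y))\<^sup>2) / 2 * ?\<kappa> x y"
      by (intro mult_right_mono) (auto simp: normal_density_nonneg)
    also have "\<dots> = 1/2 * ((norm (f x))\<^sup>2 * ?\<kappa> x y) + 1/2 * ((norm (f y))\<^sup>2 * ?\<kappa> x y)"
      by (simp add: field_simps)
    finally show "ennreal (norm (f x) * norm (f y) * ?\<kappa> x y) \<le>
      ennreal (1/2) * (ennreal ((norm (f x))\<^sup>2) * ennreal (?\<kappa> x y)) + ennreal (1/2) * (ennreal ((norm (f y))\<^sup>2) * ennreal (?\<kappa> x y))"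
      by (rule combine) (auto simp: normal_density_nonneg)
  qed
  also have "\<dots> = ennreal (1/2) * (\<integral>\<^sup>+x. \<integral>\<^sup>+y. ennreal ((norm (f x))\<^sup>2) * ennreal (?\<kappa> x y) \<partial>lebesgue \<partial>lebesgue)
     + ennreal (1/2) * (\<integral>\<^sup>+x. \<integral>\<^sup>+y. ennreal ((norm (f y))\<^sup>2) * ennreal (?\<kappa> x y) \<partial>lebesgue \<partial>lebesgue)"
    by (simp add: nn_integral_add nn_integral_cmult)
  also have "(\<integral>\<^sup>+x. \<integral>\<^sup>+y. ennreal ((norm (f x))\<^sup>2) * ennreal (?\<kappa> x y) \<partial>lebesgue \<partial>lebesgue) = ?S"
    by (simp add: nn_integral_cmult nn_integral_normal_density_shift[OF \<sigma>] S)
  also have "(\<integral>\<^sup>+x. \<integral>\<^sup>+y. ennreal ((norm (f y))\<^sup>2) * ennreal (?\<kappa> x y) \<partial>lebesgue \<partial>lebesgue) =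
     (\<integral>\<^sup>+y. \<integral>\<^sup>+x. ennreal ((norm (f y))\<^sup>2) * ennreal (?\<kappa> x y) \<partial>lebesgue \<partial>lebesgue)"
    by (rule lebesgue_pair.Fubini'[symmetric]) measurable
  also have "\<dots> = ?S"
    by (simp add: nn_integral_cmult nn_integral_normal_density_shift[OF \<sigma>] S)
  also have "ennreal (1/2) * ?S + ennreal (1/2) * ?S = ?S"
    by (simp only: half mult_1 flip: distrib_right)
  finally show ?thesis .
qed

text \<open>Unfolding one factor of |F|^2 at a time keeps every exchange of integrals
  two-dimensional: unfolding F leaves the integral of f(x) J(x), and unfolding the conjugate of F
  inside J(x) produces the Gaussian kernel of \<open>fourier_gaussian\<close>.\<close>

lemma fourier_kernel_integral_weighted_L2:
  assumes b: "b \<noteq> 0" and \<sigma>: "\<sigma> > 0" and f: "integrable lebesgue f" and sq: "integrable lebesgue (\<lambda>y. (norm (f y))\<^sup>2)"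
  shows "(\<integral>\<^sup>+\<xi>. ennreal (exp (- (\<sigma> * b * \<xi>)\<^sup>2 / 2) * (norm (fourier_kernel_integral b f \<xi>))\<^sup>2) \<partial>lebesgue)
    \<le> ennreal (2 * pi / \<bar>b\<bar> * (LINT y|lebesgue. (norm (f y))\<^sup>2))"
proof -
  define w where "w \<xi> = exp (- (\<sigma> * b * \<xi>)\<^sup>2 / 2)" for \<xi>
  define F where "F = fourier_kernel_integral b f"
  define k where "k \<xi> x = exp (- \<i> * complex_of_real (b * \<xi> * x))" for \<xi> x
  define \<kappa> where "\<kappa> x y = 2 * pi / \<bar>b\<bar> * normal_density 0 \<sigma> (y - x)" for x y
  define L where "L = (LINT y|lebesgue. norm (f y))"
  note fm[measurable] = borel_measurable_integrable[OF f]
  have Fm[measurable]: "F \<in> borel_measurable lebesgue" by (simp add: F_def)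
  have FL: "norm (F \<xi>) \<le> L" for \<xi> unfolding F_def L_def by (rule norm_fourier_kernel_integral_le[OF f])
  have L0: "L \<ge> 0" by (simp add: L_def)
  have k1: "norm (k \<xi> x) \<le> 1" for \<xi> x by (simp add: k_def)
  have km: "case_prod k \<in> borel_measurable (lebesgue \<Otimes>\<^sub>M lebesgue)"
    unfolding k_def case_prod_beta' by measurable
  \<comment> \<open>\<open>w\<close> is a multiple of the normal density with standard deviation 1 /
    (\<sigma> * |b|).\<close>
  have int_w: "integrable lebesgue w"
  proof -
    define s where "s = 1 / (\<sigma> * \<bar>b\<bar>)"
    have s: "s > 0" using b \<sigma> by (simp add: s_def)
    have "w = (\<lambda>\<xi>. sqrt (2 * pi * s\<^sup>2) * normal_density 0 s \<xi>)"
      using s b \<sigma> by (auto simp: w_def normal_density_def s_def power_mult_distrib power_divide field_simps)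
    moreover have "integrable lebesgue (normal_density 0 s)"
      using s by (intro integrable_completion[THEN iffD2]) auto
    ultimately show ?thesis by simp
  qed
  have w_nonneg: "w \<xi> \<ge> 0" for \<xi> by (simp add: w_def)
  have wm[measurable]: "w \<in> borel_measurable lebesgue" using int_w by simp
  \<comment> \<open>\<open>F\<close> itself is only known to be bounded, by the L_1 norm of f; the
    weight is what makes these products integrable.\<close>
  have int_wF: "integrable lebesgue (\<lambda>\<xi>. of_real (w \<xi>) * cnj (F \<xi>))"
    by (rule Bochner_Integration.integrable_bound[OF integrable_mult_left[OF int_w, of L]])
      (use FL L0 w_nonneg in \<open>auto simp: norm_mult mult_left_mono\<close>)
  have int_wFF: "integrable lebesgue (\<lambda>\<xi>. w \<xi> * (norm (F \<xi>))\<^sup>2)"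
    by (rule Bochner_Integration.integrable_bound[OF integrable_mult_left[OF int_w, of "L\<^sup>2"]])
      (use FL L0 w_nonneg in \<open>auto simp: abs_mult mult_left_mono power_mono\<close>)
  define J where "J x = (LINT \<xi>|lebesgue. k \<xi> x * (of_real (w \<xi>) * cnj (F \<xi>)))" for x
  define I where "I = (LINT \<xi>|lebesgue. w \<xi> * (norm (F \<xi>))\<^sup>2)"
  have "of_real I = (LINT \<xi>|lebesgue. of_real (w \<xi>) * cnj (F \<xi>) * F \<xi>)"
    unfolding I_def integral_complex_of_real[symmetric]
    by (intro Bochner_Integration.integral_cong refl) (simp add: complex_norm_square mult_ac del: of_real_power flip: of_real_power)
  also have "\<dots> = (LINT \<xi>|lebesgue. LINT x|lebesgue. k \<xi> x * (of_real (w \<xi>) * cnj (F \<xi>) * f x))"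
  proof (intro Bochner_Integration.integral_cong refl)
    fix \<xi>
    have "(LINT x|lebesgue. k \<xi> x * (of_real (w \<xi>) * cnj (F \<xi>) * f x)) =
      (LINT x|lebesgue. of_real (w \<xi>) * cnj (F \<xi>) * (k \<xi> x * f x))"
      by (simp add: mult_ac)
    then show "of_real (w \<xi>) * cnj (F \<xi>) * F \<xi> = (LINT x|lebesgue. k \<xi> x * (of_real (w \<xi>) * cnj (F \<xi>) * f x))"
      by (simp add: F_def fourier_kernel_integral_def k_def)
  qed
  also have "\<dots> = (LINT x|lebesgue. LINT \<xi>|lebesgue. k \<xi> x * (of_real (w \<xi>) * cnj (F \<xi>) * f x))"
    by (rule lebesgue_pair.Fubini_integral[symmetric], rule integrable_product_bound[OF int_wF f km k1])
  also have "\<dots> = (LINT x|lebesgue. f x * J x)"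
  proof (intro Bochner_Integration.integral_cong refl)
    fix x
    have "(LINT \<xi>|lebesgue. k \<xi> x * (of_real (w \<xi>) * cnj (F \<xi>) * f x)) =
      (LINT \<xi>|lebesgue. f x * (k \<xi> x * (of_real (w \<xi>) * cnj (F \<xi>))))"
      by (simp add: mult_ac)
    then show "(LINT \<xi>|lebesgue. k \<xi> x * (of_real (w \<xi>) * cnj (F \<xi>) * f x)) = f x * J x"
      by (simp add: J_def)
  qed
  finally have I_eq: "of_real I = (LINT x|lebesgue. f x * J x)" .
  have J_eq: "J x = (LINT y|lebesgue. cnj (f y) * of_real (\<kappa> x y))" for x
  proof -
    have "J x = (LINT \<xi>|lebesgue. LINT y|lebesgue. (k \<xi> x * cnj (k \<xi> y)) * (of_real (w \<xi>) * cnj (f y)))"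
      unfolding J_def
    proof (intro Bochner_Integration.integral_cong refl)
      fix \<xi>
      have "(LINT y|lebesgue. (k \<xi> x * cnj (k \<xi> y)) * (of_real (w \<xi>) * cnj (f y))) =
        (LINT y|lebesgue. (k \<xi> x * of_real (w \<xi>)) * cnj (k \<xi> y * f y))"
        by (simp add: mult_ac)
      also have "\<dots> = k \<xi> x * of_real (w \<xi>) * cnj (LINT y|lebesgue. k \<xi> y * f y)"
        by (simp only: integral_mult_right_zero Bochner_Integration.integral_cnj)
      finally show "k \<xi> x * (of_real (w \<xi>) * cnj (F \<xi>)) =
        (LINT y|lebesgue. (k \<xi> x * cnj (k \<xi> y)) * (of_real (w \<xi>) * cnj (f y)))"
        by (simp add: F_def fourier_kernel_integral_def k_def mult_ac)
    qed
    also have "\<dots> = (LINT y|lebesgue. LINT \<xi>|lebesgue. (k \<xi> x * cnj (k \<xi> y)) * (of_real (w \<xi>) * cnj (f y)))"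
    proof (rule lebesgue_pair.Fubini_integral[symmetric], rule integrable_product_bound)
      show "integrable lebesgue (\<lambda>\<xi>. complex_of_real (w \<xi>))" using int_w by (rule integrable_of_real)
      show "integrable lebesgue (\<lambda>y. cnj (f y))" using f by simp
      show "(\<lambda>(\<xi>, y). k \<xi> x * cnj (k \<xi> y)) \<in> borel_measurable (lebesgue \<Otimes>\<^sub>M lebesgue)"
        unfolding k_def case_prod_beta' by measurable
      show "norm (k \<xi> x * cnj (k \<xi> y)) \<le> 1" for \<xi> y by (simp add: k_def norm_mult)
    qed
    also have "\<dots> = (LINT y|lebesgue. cnj (f y) * of_real (\<kappa> x y))"
    proof (intro Bochner_Integration.integral_cong refl)
      fix y
      have "(LINT \<xi>|lebesgue. (k \<xi> x * cnj (k \<xi> y)) * (of_real (w \<xi>) * cnj (f y))) =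
        (LINT \<xi>|lebesgue. cnj (f y) * (of_real (exp (- (\<sigma> * b * \<xi>)\<^sup>2 / 2)) * exp (\<i> * of_real (b * \<xi> * (y - x)))))"
      proof (intro Bochner_Integration.integral_cong refl)
        fix \<xi>
        have "k \<xi> x * cnj (k \<xi> y) = exp (\<i> * of_real (b * \<xi> * (y - x)))"
          by (simp add: k_def exp_cnj algebra_simps flip: exp_add)
        then show "(k \<xi> x * cnj (k \<xi> y)) * (of_real (w \<xi>) * cnj (f y)) =
           cnj (f y) * (of_real (exp (- (\<sigma> * b * \<xi>)\<^sup>2 / 2)) * exp (\<i> * of_real (b * \<xi> * (y - x))))"
          by (simp add: w_def mult_ac)
      qed
      also have "\<dots> = cnj (f y) * of_real (\<kappa> x y)"
        using fourier_gaussian[OF b \<sigma>, of "y - x"] by (simp add: \<kappa>_def)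
      finally show "(LINT \<xi>|lebesgue. (k \<xi> x * cnj (k \<xi> y)) * (of_real (w \<xi>) * cnj (f y))) = cnj (f y) * of_real (\<kappa> x y)" .
    qed
    finally show ?thesis .
  qed
  have norm_le_nn: "ennreal (norm (LINT x|lebesgue. u x)) \<le> (\<integral>\<^sup>+x. ennreal (norm (u x)) \<partial>lebesgue)" for u :: "real \<Rightarrow> complex"
    by (cases "integrable lebesgue u") (auto intro: integral_norm_bound_ennreal simp: not_integrable_integral_eq)
  have "(\<integral>\<^sup>+\<xi>. ennreal (w \<xi> * (norm (F \<xi>))\<^sup>2) \<partial>lebesgue) = ennreal I"
    unfolding I_def using int_wFF w_nonneg by (intro nn_integral_eq_integral) auto
  also have "I \<ge> 0" using w_nonneg by (auto simp: I_def)
  then have "ennreal I = ennreal (norm (LINT x|lebesgue. f x * J x))" by (simp flip: I_eq)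
  also have "\<dots> \<le> (\<integral>\<^sup>+x. ennreal (norm (f x * J x)) \<partial>lebesgue)" by (rule norm_le_nn)
  also have "\<dots> \<le> (\<integral>\<^sup>+x. \<integral>\<^sup>+y. ennreal (2 * pi / \<bar>b\<bar>) * ennreal (norm (f x) * norm (f y) * normal_density 0 \<sigma> (y - x)) \<partial>lebesgue \<partial>lebesgue)"
  proof (intro nn_integral_mono)
    fix x
    have "ennreal (norm (f x * J x)) = ennreal (norm (f x)) * ennreal (norm (J x))"
      by (simp add: norm_mult ennreal_mult)
    also have "\<dots> \<le> ennreal (norm (f x)) * (\<integral>\<^sup>+y. ennreal (norm (cnj (f y) * of_real (\<kappa> x y))) \<partial>lebesgue)"
      unfolding J_eq by (intro mult_left_mono norm_le_nn) auto
    also have "\<dots> = (\<integral>\<^sup>+y. ennreal (norm (f x)) * ennreal (norm (cnj (f y) * of_real (\<kappa> x y))) \<partial>lebesgue)"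
      by (rule nn_integral_cmult[symmetric]) (unfold \<kappa>_def, measurable)
    also have "\<dots> = (\<integral>\<^sup>+y. ennreal (2 * pi / \<bar>b\<bar>) * ennreal (norm (f x) * norm (f y) * normal_density 0 \<sigma> (y - x)) \<partial>lebesgue)"
    proof (intro nn_integral_cong)
      fix y
      have \<kappa>0: "\<kappa> x y \<ge> 0" by (simp add: \<kappa>_def normal_density_nonneg)
      have "ennreal (norm (f x)) * ennreal (norm (cnj (f y) * of_real (\<kappa> x y))) = ennreal (norm (f x) * (norm (f y) * \<kappa> x y))"
        using \<kappa>0 by (simp add: norm_mult flip: ennreal_mult)
      also have "norm (f x) * (norm (f y) * \<kappa> x y) = 2 * pi / \<bar>b\<bar> * (norm (f x) * norm (f y) * normal_density 0 \<sigma> (y - x))"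
        by (simp add: \<kappa>_def)
      also have "ennreal \<dots> = ennreal (2 * pi / \<bar>b\<bar>) * ennreal (norm (f x) * norm (f y) * normal_density 0 \<sigma> (y - x))"
        by (rule ennreal_mult) (auto simp: normal_density_nonneg)
      finally show "ennreal (norm (f x)) * ennreal (norm (cnj (f y) * of_real (\<kappa> x y))) =
        ennreal (2 * pi / \<bar>b\<bar>) * ennreal (norm (f x) * norm (f y) * normal_density 0 \<sigma> (y - x))" .
    qed
    finally show "ennreal (norm (f x * J x)) \<le> (\<integral>\<^sup>+y. ennreal (2 * pi / \<bar>b\<bar>) * ennreal (norm (f x) * norm (f y) * normal_density 0 \<sigma> (y - x)) \<partial>lebesgue)" .
  qed
  also have "\<dots> = ennreal (2 * pi / \<bar>b\<bar>) * (\<integral>\<^sup>+x. \<integral>\<^sup>+y. ennreal (norm (f x) * norm (f y) * normal_density 0 \<sigma> (y - x)) \<partial>lebesgue \<partial>lebesgue)"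
  proof -
    note [measurable] = measurable_compose[OF measurable_fst fm] measurable_compose[OF measurable_snd fm]
    show ?thesis by (simp add: nn_integral_cmult)
  qed
  also have "\<dots> \<le> ennreal (2 * pi / \<bar>b\<bar>) * ennreal (LINT y|lebesgue. (norm (f y))\<^sup>2)"
    by (intro mult_left_mono gaussian_quadratic_form_le[OF \<sigma> fm sq]) auto
  also have "\<dots> = ennreal (2 * pi / \<bar>b\<bar> * (LINT y|lebesgue. (norm (f y))\<^sup>2))"
    by (rule ennreal_mult[symmetric]) auto
  finally show ?thesis by (simp only: w_def F_def)
qed

text \<open>The weighted bound does not contain \<sigma>. Along \<sigma> = 1/(n+1) the weights tend
  to 1, and Fatou's lemma applies.\<close>

lemma fourier_kernel_integral_L2:
  assumes b: "b \<noteq> 0" and f: "integrable lebesgue f" and sq: "integrable lebesgue (\<lambda>y. (norm (f y))\<^sup>2)"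
  shows "(\<integral>\<^sup>+\<xi>. ennreal ((norm (fourier_kernel_integral b f \<xi>))\<^sup>2) \<partial>lebesgue)
    \<le> ennreal (2 * pi / \<bar>b\<bar> * (LINT y|lebesgue. (norm (f y))\<^sup>2))"
proof -
  define v where "v n \<xi> = exp (- (1 / real (Suc n) * b * \<xi>)\<^sup>2 / 2) * (norm (fourier_kernel_integral b f \<xi>))\<^sup>2" for n \<xi>
  note [measurable] = borel_measurable_integrable[OF f]
  have "(\<integral>\<^sup>+\<xi>. ennreal ((norm (fourier_kernel_integral b f \<xi>))\<^sup>2) \<partial>lebesgue) = (\<integral>\<^sup>+\<xi>. liminf (\<lambda>n. ennreal (v n \<xi>)) \<partial>lebesgue)"
  proof (intro nn_integral_cong)
    fix \<xi>
    have "(\<lambda>n. 1 / real (Suc n)) \<longlonglongrightarrow> 0" using LIMSEQ_inverse_real_of_nat by (simp add: inverse_eq_divide)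
    then have "(\<lambda>n. v n \<xi>) \<longlonglongrightarrow> exp (- (0 * b * \<xi>)\<^sup>2 / 2) * (norm (fourier_kernel_integral b f \<xi>))\<^sup>2"
      unfolding v_def by (intro tendsto_intros) auto
    then have "(\<lambda>n. ennreal (v n \<xi>)) \<longlonglongrightarrow> ennreal ((norm (fourier_kernel_integral b f \<xi>))\<^sup>2)"
      by (intro tendsto_ennrealI) simp
    then show "ennreal ((norm (fourier_kernel_integral b f \<xi>))\<^sup>2) = liminf (\<lambda>n. ennreal (v n \<xi>))"
      using lim_imp_Liminf[OF trivial_limit_sequentially] by fastforce
  qed
  also have "\<dots> \<le> liminf (\<lambda>n. \<integral>\<^sup>+\<xi>. ennreal (v n \<xi>) \<partial>lebesgue)"
    by (rule nn_integral_liminf) (simp add: v_def)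
  also have "\<dots> \<le> liminf (\<lambda>n. ennreal (2 * pi / \<bar>b\<bar> * (LINT y|lebesgue. (norm (f y))\<^sup>2)))"
    unfolding v_def
    by (intro Liminf_mono always_eventually allI fourier_kernel_integral_weighted_L2 b f sq) auto
  finally show ?thesis by (simp add: Liminf_const)
qed

section \<open>Real exponents in \<open>Lp_space\<close>, unimodular factors and linearity of the
  Fourier integral\<close>

lemma Lp_space_ennreal: "r \<ge> 0 \<Longrightarrow> Lp_space (ennreal r) = Lr lebesgue r"
  by (simp add: Lp_space_def Lr_def)

lemma Lp_norm_ennreal: "r \<ge> 0 \<Longrightarrow> Lp_norm (ennreal r) f = Lr_norm lebesgue r f"
  by (simp add: Lp_norm_def Lr_norm_def)

lemma Lp_space_1: "Lp_space 1 = {f. integrable lebesgue f}"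
proof -
  have "Lp_space (ennreal 1) = Lr lebesgue 1" by (rule Lp_space_ennreal) simp
  then show ?thesis by (intro set_eqI) (simp only: ennreal_1 Lr_1 mem_Collect_eq)
qed

lemma borel_measurable_lebesgue_continuous:
  fixes f :: "'a::euclidean_space \<Rightarrow> 'b::topological_space"
  assumes "continuous_on UNIV f"
  shows "f \<in> borel_measurable lebesgue"
  using borel_measurable_continuous_onI[OF assms] by (intro measurable_completion) simp

lemma integrable_unimodular_mult:
  fixes f u :: "'a \<Rightarrow> complex"
  assumes f: "integrable M f" and u: "u \<in> borel_measurable M" "\<And>y. norm (u y) = 1"
  shows "integrable M (\<lambda>y. u y * f y)"
proof (rule Bochner_Integration.integrable_bound[OF f])
  show "(\<lambda>y. u y * f y) \<in> borel_measurable M"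
    using u(1) borel_measurable_integrable[OF f] by (rule borel_measurable_times)
qed (simp add: norm_mult u(2))

lemma integrable_fourier_factor_mult:
  assumes "integrable lebesgue f"
  shows "integrable lebesgue (\<lambda>y. exp (- \<i> * of_real (b * \<xi> * y)) * f y)"
proof (rule integrable_unimodular_mult[OF assms])
  show "(\<lambda>y. exp (- \<i> * complex_of_real (b * \<xi> * y))) \<in> borel_measurable lebesgue"
    by (intro borel_measurable_lebesgue_continuous continuous_intros)
qed simp

lemma fourier_kernel_integral_add:
  assumes "integrable lebesgue f" "integrable lebesgue g"
  shows "fourier_kernel_integral b (\<lambda>y. f y + g y) \<xi> = fourier_kernel_integral b f \<xi> + fourier_kernel_integral b g \<xi>"
  unfolding fourier_kernel_integral_def
  using integrable_fourier_factor_mult[OF assms(1), of b \<xi>] integrable_fourier_factor_mult[OF assms(2), of b \<xi>]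
  by (simp add: distrib_left)

lemma fourier_kernel_integral_mult:
  "fourier_kernel_integral b (\<lambda>y. c * f y) \<xi> = c * fourier_kernel_integral b f \<xi>"
  by (simp add: fourier_kernel_integral_def mult.left_commute)

section \<open>The quadratic Hartley operator\<close>

definition chirp :: "real \<Rightarrow> real \<Rightarrow> real \<Rightarrow> complex" where
  "chirp c e y = exp (- \<i> * of_real (c * y\<^sup>2 + e * y))"

lemma norm_chirp [simp]: "norm (chirp c e y) = 1"
  by (simp add: chirp_def)

lemma borel_measurable_chirp [measurable]: "chirp c e \<in> borel_measurable lebesgue"
  unfolding chirp_def by (intro borel_measurable_lebesgue_continuous continuous_intros)

lemma integrable_chirp_mult:
  assumes "integrable lebesgue f"
  shows "integrable lebesgue (\<lambda>y. chirp c e y * f y)"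
  by (rule integrable_unimodular_mult[OF assms borel_measurable_chirp norm_chirp])

text \<open>The phase is (a x^2 + d x) + b x y + (c y^2 + e y). Only the middle term couples the
  variables; the outer ones become chirps, and reflecting x turns the frequency b into -b.\<close>

lemma hartley_integral_eq_fourier:
  assumes f: "integrable lebesgue f"
  shows "hartley_integral a b c d e z f x = of_real (sqrt (\<bar>b\<bar> / (2 * pi)) / 2) *
    (chirp a d x * fourier_kernel_integral b (\<lambda>y. chirp c e y * f y) x
     + z * chirp a d (- x) * fourier_kernel_integral (- b) (\<lambda>y. chirp c e y * f y) x)"
proof -
  define g where "g y = chirp c e y * f y" for y
  have g: "integrable lebesgue g" unfolding g_def by (rule integrable_chirp_mult[OF f])
  note int = integrable_fourier_factor_mult[OF g, of _ x]
  have phase: "exp (- \<i> * of_real (quad_phase a b c d e x' y)) = chirp a d x' * exp (- \<i> * of_real (b * x' * y)) * chirp c e y" for x' y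
    by (simp add: chirp_def quad_phase_def algebra_simps flip: exp_add)
  have "(LINT y|lebesgue. (exp (- \<i> * of_real (quad_phase a b c d e x y))
          + z * exp (- \<i> * of_real (quad_phase a b c d e (- x) y))) / 2 * f y) =
     (LINT y|lebesgue. chirp a d x / 2 * (exp (- \<i> * of_real (b * x * y)) * g y)
          + z * chirp a d (- x) / 2 * (exp (- \<i> * of_real (- b * x * y)) * g y))"
    unfolding phase by (intro Bochner_Integration.integral_cong refl) (simp add: g_def field_simps)
  also have "\<dots> = chirp a d x / 2 * fourier_kernel_integral b g x
     + z * chirp a d (- x) / 2 * fourier_kernel_integral (- b) g x"
    unfolding fourier_kernel_integral_def using int[of b] int[of "- b"]
    by (subst Bochner_Integration.integral_add) (auto intro!: integrable_mult_right)
  finally show ?thesis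
    unfolding hartley_integral_def g_def[symmetric] by (simp add: field_simps)
qed

text \<open>Chirps and z are unimodular, so only the two Fourier integrals count. For the pointwise
  bound the factor 1/2 cancels their number; for L_2 the same happens after (u + v)^2 \<le> 2 (u^2 +
  v^2).\<close>

lemma L1_L2_operator_hartley:
  assumes b: "b \<noteq> 0" and z: "norm z = 1"
  shows "L1_L2_operator lebesgue lebesgue (hartley_integral a b c d e z) (sqrt (\<bar>b\<bar> / (2 * pi)))"
proof
  let ?C = "sqrt (\<bar>b\<bar> / (2 * pi))"
  let ?g = "\<lambda>f y. chirp c e y * f y"
  show "?C > 0" using b by simp
  fix f :: "real \<Rightarrow> complex" assume f: "integrable lebesgue f"
  note g = integrable_chirp_mult[OF f, of c e]
  note [measurable] = borel_measurable_integrable[OF g]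
  have [measurable]: "(\<lambda>x. chirp a d (- x)) \<in> borel_measurable lebesgue"
    unfolding chirp_def by (intro borel_measurable_lebesgue_continuous continuous_intros)
  show meas: "hartley_integral a b c d e z f \<in> borel_measurable lebesgue"
    unfolding hartley_integral_eq_fourier[OF f, abs_def] by measurable
  have norm_le: "norm (hartley_integral a b c d e z f x) \<le>
    ?C / 2 * (norm (fourier_kernel_integral b (?g f) x) + norm (fourier_kernel_integral (- b) (?g f) x))" for x
  proof -
    have "norm (chirp a d x * fourier_kernel_integral b (?g f) x + z * chirp a d (- x) * fourier_kernel_integral (- b) (?g f) x)
      \<le> norm (fourier_kernel_integral b (?g f) x) + norm (fourier_kernel_integral (- b) (?g f) x)"
      by (rule order_trans[OF norm_triangle_ineq]) (simp add: norm_mult z)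
    then show ?thesis
      unfolding hartley_integral_eq_fourier[OF f] norm_mult by (intro mult_mono) auto
  qed
  show "norm (hartley_integral a b c d e z f x) \<le> ?C * (LINT y|lebesgue. norm (f y))" for x
  proof -
    have "norm (hartley_integral a b c d e z f x) \<le> ?C / 2 * ((LINT y|lebesgue. norm (?g f y)) + (LINT y|lebesgue. norm (?g f y)))"
      by (rule order_trans[OF norm_le]) (intro mult_left_mono add_mono norm_fourier_kernel_integral_le g, simp)
    then show ?thesis by (simp add: norm_mult)
  qed
  show "hartley_integral a b c d e z (\<lambda>y. c' * f y) x = c' * hartley_integral a b c d e z f x" for c' x
  proof -
    have "?g (\<lambda>y. c' * f y) = (\<lambda>y. c' * ?g f y)" by (simp add: fun_eq_iff)
    then show ?thesis using f
      by (simp add: hartley_integral_eq_fourier fourier_kernel_integral_mult algebra_simps)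
  qed
  show "hartley_integral a b c d e z (\<lambda>y. f y + h y) x = hartley_integral a b c d e z f x + hartley_integral a b c d e z h x"
    if h: "integrable lebesgue h" for h x
  proof -
    have "?g (\<lambda>y. f y + h y) = (\<lambda>y. ?g f y + ?g h y)" by (simp add: fun_eq_iff distrib_left)
    then show ?thesis using f h g integrable_chirp_mult[OF h, of c e]
      by (simp add: hartley_integral_eq_fourier fourier_kernel_integral_add algebra_simps)
  qed
  show "(\<integral>\<^sup>+x. ennreal ((norm (hartley_integral a b c d e z f x))\<^sup>2) \<partial>lebesgue) \<le> ennreal (LINT y|lebesgue. (norm (f y))\<^sup>2)"
    if sq: "integrable lebesgue (\<lambda>y. (norm (f y))\<^sup>2)"
  proof -
    define S where "S = (LINT y|lebesgue. (norm (f y))\<^sup>2)"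
    define F where "F b' x = norm (fourier_kernel_integral b' (?g f) x)" for b' x
    have F_L2: "(\<integral>\<^sup>+x. ennreal ((F b' x)\<^sup>2) \<partial>lebesgue) \<le> ennreal (2 * pi / \<bar>b\<bar> * S)" if "b' \<noteq> 0" "\<bar>b'\<bar> = \<bar>b\<bar>" for b'
      using fourier_kernel_integral_L2[OF that(1) g] sq that(2) by (simp add: F_def S_def norm_mult)
    have [measurable]: "F b' \<in> borel_measurable lebesgue" for b' unfolding F_def by measurable
    \<comment> \<open>\<open>?C\<close>^2 / 4 = |b| / (8 pi), doubled by the inequality for (u +
      v)^2. Against the two Plancherel bounds 2 pi / |b| it gives exactly 1.\<close>
    define k where "k = \<bar>b\<bar> / (4 * pi)"
    have k: "k \<ge> 0" by (simp add: k_def)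
    have "(\<integral>\<^sup>+x. ennreal ((norm (hartley_integral a b c d e z f x))\<^sup>2) \<partial>lebesgue) \<le>
      (\<integral>\<^sup>+x. ennreal k * (ennreal ((F b x)\<^sup>2) + ennreal ((F (- b) x)\<^sup>2)) \<partial>lebesgue)"
    proof (intro nn_integral_mono)
      fix x
      have "(norm (hartley_integral a b c d e z f x))\<^sup>2 \<le> (?C / 2 * (F b x + F (- b) x))\<^sup>2"
        using norm_le[of x] by (intro power_mono) (auto simp: F_def)
      also have "\<dots> = \<bar>b\<bar> / (8 * pi) * (F b x + F (- b) x)\<^sup>2"
        by (simp add: power_mult_distrib power_divide)
      also have "\<dots> \<le> \<bar>b\<bar> / (8 * pi) * (2 * ((F b x)\<^sup>2 + (F (- b) x)\<^sup>2))"
        using sum_squares_bound[of "F b x" "F (- b) x"] by (intro mult_left_mono) (auto simp: power2_sum)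
      also have "\<dots> = k * ((F b x)\<^sup>2 + (F (- b) x)\<^sup>2)" by (simp add: k_def field_simps)
      finally show "ennreal ((norm (hartley_integral a b c d e z f x))\<^sup>2) \<le> ennreal k * (ennreal ((F b x)\<^sup>2) + ennreal ((F (- b) x)\<^sup>2))"
        using k by (simp add: ennreal_leI flip: ennreal_mult ennreal_plus)
    qed
    also have "\<dots> = ennreal k * ((\<integral>\<^sup>+x. ennreal ((F b x)\<^sup>2) \<partial>lebesgue) + (\<integral>\<^sup>+x. ennreal ((F (- b) x)\<^sup>2) \<partial>lebesgue))"
      by (simp add: nn_integral_cmult nn_integral_add)
    also have "\<dots> \<le> ennreal k * (ennreal (2 * pi / \<bar>b\<bar> * S) + ennreal (2 * pi / \<bar>b\<bar> * S))"
      using b by (intro mult_left_mono add_mono F_L2) auto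
    also have "\<dots> = ennreal (k * (2 * pi / \<bar>b\<bar> * S + 2 * pi / \<bar>b\<bar> * S))"
    proof -
      have "2 * pi / \<bar>b\<bar> * S \<ge> 0" by (simp add: S_def)
      then show ?thesis using k by (simp only: ennreal_mult ennreal_plus add_nonneg_nonneg)
    qed
    also have "k * (2 * pi / \<bar>b\<bar> * S + 2 * pi / \<bar>b\<bar> * S) = S" using b by (simp add: k_def field_simps)
    finally show ?thesis by (simp add: S_def)
  qed
qed

section \<open>The endpoint L_infinity and conjugate exponents\<close>

lemma Lp_infinity:
  assumes [measurable]: "f \<in> borel_measurable lebesgue" and bound: "\<And>x. norm (f x) \<le> B"
  shows "f \<in> Lp_space \<infinity>" "0 \<le> Lp_norm \<infinity> f" "Lp_norm \<infinity> f \<le> B"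
proof -
  have le: "esssup lebesgue (\<lambda>x. ereal (norm (f x))) \<le> ereal B"
    using bound by (intro esssup_I) auto
  \<comment> \<open>On a null space the essential supremum would be -\<infinity>. Here it is at
    least 0, and with the upper bound it is finite, so \<open>real_of_ereal\<close> loses
    nothing.\<close>
  have "emeasure lebesgue (space (lebesgue :: real measure)) \<noteq> 0" by simp
  then have "ereal 0 = esssup (lebesgue :: real measure) (\<lambda>x. ereal 0)" by (rule esssup_const[symmetric])
  also have "\<dots> \<le> esssup lebesgue (\<lambda>x. ereal (norm (f x)))" by (intro esssup_mono) auto
  finally have ge: "0 \<le> esssup lebesgue (\<lambda>x. ereal (norm (f x)))" by (simp add: zero_ereal_def)
  show "f \<in> Lp_space \<infinity>" using le by (auto simp: Lp_space_def)
  show "0 \<le> Lp_norm \<infinity> f" using ge by (simp add: Lp_norm_def real_of_ereal_pos)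
  show "Lp_norm \<infinity> f \<le> B"
    using le ge by (cases "esssup lebesgue (\<lambda>x. ereal (norm (f x)))") (auto simp: Lp_norm_def)
qed

lemma ennreal_conjugate_exponent:
  assumes "p \<ge> 1" "1 / ennreal p + 1 / p\<^sub>1 = 1"
  shows "p = 1 \<and> p\<^sub>1 = \<infinity> \<or> p > 1 \<and> (\<exists>q. q > 0 \<and> p\<^sub>1 = ennreal q \<and> 1 / p + 1 / q = 1)"
proof -
  have ip: "1 / ennreal p = ennreal (1 / p)" using assms by (simp flip: ennreal_1 add: divide_ennreal)
  show ?thesis
  proof (cases p\<^sub>1)
    case top
    then have "ennreal (1 / p) = ennreal 1" using assms ip by simp
    then have "p = 1" using assms(1) by (subst (asm) ennreal_inj) auto
    then show ?thesis using top by simp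
  next
    case (real q)
    \<comment> \<open>In \<open>ennreal\<close> the quotient 1 / 0 is infinite, which the equation
      excludes.\<close>
    have "q \<noteq> 0" using assms(2) real by (auto simp: ennreal_divide_zero)
    then have q: "q > 0" using real by simp
    then have "1 / p\<^sub>1 = ennreal (1 / q)" using real by (simp flip: ennreal_1 add: divide_ennreal)
    then have "ennreal (1 / p + 1 / q) = ennreal 1" using assms ip q by (simp add: ennreal_plus)
    then have eq: "1 / p + 1 / q = 1" using assms(1) q by (subst (asm) ennreal_inj) auto
    then have "p \<noteq> 1" using q by auto
    then show ?thesis using assms(1) eq q real by auto
  qed
qed

theorem theorem2p4:
  fixes a b c d e p :: real and z :: complex and p\<^sub>1 :: ennreal
  assumes "b \<noteq> 0"
    and "z \<in> {\<i>, - \<i>}"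
    and "p \<in> {1..2}"
    and "1 / ennreal p + 1 / p\<^sub>1 = 1"
  shows "\<forall>f \<in> Lp_space (ennreal p).
           quad_hartley a b c d e z (ennreal p) p\<^sub>1 f \<in> Lp_space p\<^sub>1 \<and>
           Lp_norm p\<^sub>1 (quad_hartley a b c d e z (ennreal p) p\<^sub>1 f)
             \<le> sqrt (\<bar>b\<bar> / (2 * pi)) powr (2 / p - 1) * Lp_norm (ennreal p) f"
proof -
  let ?H = "hartley_integral a b c d e z" and ?C = "sqrt (\<bar>b\<bar> / (2 * pi))"
  have "norm z = 1" using assms(2) by auto
  then interpret L1_L2_operator lebesgue lebesgue ?H ?C
    using assms(1) by (rule L1_L2_operator_hartley[rotated])
  define T where "T = quad_hartley a b c d e z (ennreal p) p\<^sub>1"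
  \<comment> \<open>The chosen \<open>T\<close> has the defining properties once some extension
    exists, so each case below first exhibits one.\<close>
  have ext: "is_hartley_extension a b c d e z (ennreal p) p\<^sub>1 T" if "\<exists>T. is_hartley_extension a b c d e z (ennreal p) p\<^sub>1 T"
    unfolding T_def quad_hartley_def using that by (rule someI_ex)
  consider "p = 1" "p\<^sub>1 = \<infinity>" | q where "p > 1" "q > 0" "p\<^sub>1 = ennreal q" "1 / p + 1 / q = 1"
    using ennreal_conjugate_exponent[OF _ assms(4)] assms(3) by auto
  then have "\<forall>f \<in> Lp_space (ennreal p). T f \<in> Lp_space p\<^sub>1 \<and> Lp_norm p\<^sub>1 (T f) \<le> ?C powr (2 / p - 1) * Lp_norm (ennreal p) f"
  proof cases
    case 1
    have L1: "Lp_norm 1 f = (LINT y|lebesgue. norm (f y))" for f by (simp add: Lp_norm_def)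
    note Hinf = Lp_infinity[OF T_measurable T_bound]
    have "is_hartley_extension a b c d e z 1 \<infinity> ?H"
      unfolding is_hartley_extension_def Lp_space_1
    proof (intro conjI ballI allI impI)
      fix F :: "nat \<Rightarrow> real \<Rightarrow> complex" and f
      assume F: "\<forall>n. F n \<in> {f. integrable lebesgue f}" and f: "f \<in> {f. integrable lebesgue f}"
        and lim: "(\<lambda>n. Lp_norm 1 (\<lambda>x. F n x - f x)) \<longlonglongrightarrow> 0"
      have int: "integrable lebesgue (\<lambda>x. F n x - f x)" for n using F f by auto
      have eq: "?H (\<lambda>x. F n x - f x) = (\<lambda>x. ?H (F n) x - ?H f x)" for n
        using F f by (simp add: T_diff fun_eq_iff)
      show "(\<lambda>n. Lp_norm \<infinity> (\<lambda>x. ?H (F n) x - ?H f x)) \<longlonglongrightarrow> 0"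
      proof (rule Lim_null_comparison)
        show "\<forall>\<^sub>F n in sequentially. norm (Lp_norm \<infinity> (\<lambda>x. ?H (F n) x - ?H f x)) \<le> ?C * Lp_norm 1 (\<lambda>x. F n x - f x)"
          using Hinf(2,3)[OF int int] by (simp add: eq L1)
        show "(\<lambda>n. ?C * Lp_norm 1 (\<lambda>x. F n x - f x)) \<longlonglongrightarrow> 0"
          using tendsto_mult_left[OF lim, of ?C] by simp
      qed
    qed (use Hinf(1) in auto)
    then have "is_hartley_extension a b c d e z 1 \<infinity> T" using ext 1 by auto
    \<comment> \<open>For p = 1 the agreement clause ranges over all of L_1, so the choice is the
      integral operator.\<close>
    then have "T f = ?H f" if "integrable lebesgue f" for f
      using that by (auto simp: is_hartley_extension_def Lp_space_1)
    then show ?thesis using Hinf(1,3) C_pos by (auto simp: 1 Lp_space_1 L1)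
  next
    case (2 q)
    have p: "1 < p" "p \<le> 2" using assms(3) 2 by auto
    have simps: "Lp_space (ennreal p) = Lr lebesgue p" "Lp_norm (ennreal p) = Lr_norm lebesgue p"
      "Lp_space p\<^sub>1 = Lr lebesgue q" "Lp_norm p\<^sub>1 = Lr_norm lebesgue q"
      using p 2 by (auto simp: Lp_space_ennreal Lp_norm_ennreal fun_eq_iff)
    obtain T' where T': "\<And>f. f \<in> Lr lebesgue p \<Longrightarrow> T' f \<in> Lr lebesgue q"
      "\<And>f. integrable lebesgue f \<Longrightarrow> f \<in> Lr lebesgue p \<Longrightarrow> T' f = ?H f"
      "\<And>f g. f \<in> Lr lebesgue p \<Longrightarrow> g \<in> Lr lebesgue p \<Longrightarrow>
         Lr_norm lebesgue q (\<lambda>x. T' f x - T' g x) \<le> ?C powr (2 / p - 1) * Lr_norm lebesgue p (\<lambda>y. f y - g y)"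
      using continuous_extension_exists[OF p 2(4)] by blast
    have "is_hartley_extension a b c d e z (ennreal p) p\<^sub>1 T'"
      unfolding is_hartley_extension_def Lp_space_1 simps
    proof (intro conjI ballI allI impI)
      fix F :: "nat \<Rightarrow> real \<Rightarrow> complex" and f
      assume F: "\<forall>n. F n \<in> Lr lebesgue p" and f: "f \<in> Lr lebesgue p"
        and lim: "(\<lambda>n. Lr_norm lebesgue p (\<lambda>x. F n x - f x)) \<longlonglongrightarrow> 0"
      show "(\<lambda>n. Lr_norm lebesgue q (\<lambda>x. T' (F n) x - T' f x)) \<longlonglongrightarrow> 0"
      proof (rule Lim_null_comparison)
        show "\<forall>\<^sub>F n in sequentially. norm (Lr_norm lebesgue q (\<lambda>x. T' (F n) x - T' f x))
            \<le> ?C powr (2 / p - 1) * Lr_norm lebesgue p (\<lambda>x. F n x - f x)"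
          using T'(3) F f by simp
        show "(\<lambda>n. ?C powr (2 / p - 1) * Lr_norm lebesgue p (\<lambda>x. F n x - f x)) \<longlonglongrightarrow> 0"
          using tendsto_mult_left[OF lim, of "?C powr (2 / p - 1)"] by simp
      qed
    qed (use T' in auto)
    \<comment> \<open>\<open>T'\<close> serves only to show existence. The chosen \<open>T\<close>
      may differ from it, and its bound comes from
      \<open>continuous_extension_bound\<close>.\<close>
    then have T: "is_hartley_extension a b c d e z (ennreal p) p\<^sub>1 T" using ext by blast
    then have "Lr_norm lebesgue q (T f) \<le> ?C powr (2 / p - 1) * Lr_norm lebesgue p f" if "f \<in> Lr lebesgue p" for f
      by (intro continuous_extension_bound[OF p 2(4) _ _ _ that])
        (auto simp: is_hartley_extension_def Lp_space_1 simps)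
    with T show ?thesis by (auto simp: is_hartley_extension_def simps)
  qed
  then show ?thesis by (simp add: T_def)
qed

end
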